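(* Let $k\in C^2([0,1])$ be a positive function which has a unique global minimum, located at a point $\xi^\ast\in(0,1)$, with $k'(\xi^\ast)=0$ and $k''(\xi^\ast)>0$. Let $\mathcal{G}_1,\dots,\mathcal{G}_8\subset(0,1)^2$ be the regions, and let singular solutions and their types $1,\dots,8$ be as defined in the context. Then for each $i=1,\dots,8$ and each $(\alpha,\beta)\in\mathcal{G}_i$ there exists a unique singular solution $\Gamma^i$ of type $i$, composed of segments of orbits of the layer problem and of the reduced problem and satisfying the boundary conditions $j=\alpha(1-\rho)$ at $\xi=0$ and $j=\beta\rho$ at $\xi=1$.
   Context: The underlying boundary value problem is $\frac{d}{dx}(k(x)j)=0$, $j=-\varepsilon\frac{d\rho}{dx}+\rho(1-\rho)$ on $[0,1]$, with $j=\alpha(1-\rho)$ at $x=0$ and $j=\beta\rho$ at $x=1$. With $g=k'/k$ and $\xi=x$ it is the slow-fast system $\dot j=-g(\xi)j$, $\dot\xi=1$, $\varepsilon\dot\rho=\rho(1-\rho)-j$. "Singular" refers to $\varepsilon=0$. Layer problem: $j'=0$, $\xi'=0$, $\rho'=\rho(1-\rho)-j$. Its set of equilibria is the critical manifold $\mathcal{C}_0=\{(j,\xi,\rho): j=\rho(1-\rho)\}$, with attracting part $\mathcal{C}_0^a=\mathcal{C}_0\cap\{\rho>\frac12\}$, repelling part $\mathcal{C}_0^r=\mathcal{C}_0\cap\{\rho<\frac12\}$ and fold line $F=\{j=\frac14,\rho=\frac12\}$. Reduced problem on $\mathcal{C}_0$ (in the variables $(\xi,\rho)\in[0,1]^2$,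 with $j=\rho(1-\rho)$): $\dot\xi=1$, $(1-2\rho)\dot\rho=-g(\xi)\rho(1-\rho)$; the quantity $k(\xi)\rho(1-\rho)$ is constant along its orbits. The canard point is $p^\ast=(j,\xi,\rho)=(\frac14,\xi^\ast,\frac12)\in F$. The canard $S_c$ is the orbit given by $\rho=\frac12(1+\sqrt{1-k(\xi^\ast)/k(\xi)})$ for $0\le\xi\le\xi^\ast$ and $\rho=\frac12(1-\sqrt{1-k(\xi^\ast)/k(\xi)})$ for $\xi^\ast\le\xi\le1$; it passes through $p^\ast$ from $\mathcal{C}_0^a$ to $\mathcal{C}_0^r$, and reduced orbits are allowed to pass through $p^\ast$ along it. Admissible boundary points: $\mathcal{L}=\{(\alpha(1-s),0,s):\rho_\alpha\le s\le1\}$ and $\mathcal{R}=\{(\beta t,1,t):0\le t\le\rho_\beta\}$, where $\rho_\alpha=\alpha$ if $\alpha\le\frac12$, $\rho_\alpha=1-\frac1{4\alpha}$ if $\alpha\ge\frac12$; $\rho_\beta=1-\beta$ if $\beta\le\frac12$, $\rho_\beta=\frac1{4\beta}$ if $\beta\ge\frac12$. Singular solution: a connected oriented curve in $(j,\xi,\rho)$-space from a point $p_0\in\mathcal{L}$ to a point $p_1\in\mathcal{R}$ which is a concatenation of segments of orbits of the layer problem, traversed in the direction of its flow, and of orbits of the reduced problem on $\mathcal{C}_0$, traversed in the direction of increasing $\xi$. A "layer at $\xi=0$" (resp. "at $\xi=1$") is a nontrivial segment of a layer-problem orbit in $\{\xi=0\}$ joining $p_0$ to $\mathcal{C}_0$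 (resp. in $\{\xi=1\}$ joining $\mathcal{C}_0$ to $p_1$). Types: - Type 1: singular solutions which start on $\mathcal{C}_0^r$ at $\xi=0$, follow the reduced flow on $\mathcal{C}_0^r$ (where $\rho$ increases), and have a layer at $\xi=1$ in which $\rho$ increases. - Type 2: singular solutions which start on $\mathcal{C}_0^r$ at $\xi=0$, follow the reduced flow on $\mathcal{C}_0^r$ (where $\rho$ increases), and have a layer at $\xi=1$ in which $\rho$ decreases. - Type 3: singular solutions which have a layer at $\xi=0$ in which $\rho$ increases, follow the reduced flow on $\mathcal{C}_0$ (where $\rho$ decreases) passing through the point $p^\ast$, and have another layer at $\xi=1$ in which $\rho$ increases. - Type 4: singular solutions which have a layer at $\xi=0$ in which $\rho$ increases, follow the reduced flow on $\mathcal{C}_0$ (where $\rho$ decreases) passing through the point $p^\ast$, and have another layer at $\xi=1$ in which $\rho$ decreases. - Type 5: singular solutions which have a layer at $\xi=0$ in which $\rho$ decreases, follow the reduced flow on $\mathcal{C}_0$ (where $\rho$ decreases) passing through the point $p^\ast$, and have another layer at $\xi=1$ in which $\rho$ increases. - Type 6: singular solutions which have a layer at $\xi=0$ in which $\rho$ decreases, follow the reduced flow on $\mathcal{C}_0$ (where $\rho$ decreases) passing through the point $p^\ast$, and have another layer at $\xi=1$ in which $\rho$ decreases. - Type 7: singular solutions which have a layer at $\xi=0$ in which $\rho$ increases, and follow the reduced flow on $\mathcal{C}_0^a$ (where $\rho$ decreases). - Type 8: singular solutions which have a layer at $\xi=0$ in which $\rho$ decreases, and follow the reduced flow on $\mathcal{C}_0^a$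 (where $\rho$ decreases). Constants: $\rho_c^0=\tfrac12(1-\sqrt{1-k(\xi^\ast)/k(0)})\in(0,\frac12)$, $\rho_c^1=\tfrac12(1+\sqrt{1-k(\xi^\ast)/k(1)})\in(\frac12,1)$; for $0<\alpha<\rho_c^0$, $\rho^\ast(\alpha)=\tfrac12(1-\sqrt{1-4\alpha(1-\alpha)k(0)/k(1)})$; for $0<\beta<1-\rho_c^1$, $\rho_\ast(\beta)=\tfrac12(1+\sqrt{1-4\beta(1-\beta)k(1)/k(0)})$. Regions: - $\mathcal{G}_1=\{0<\alpha<\rho_c^0,\ \rho^\ast(\alpha)<\beta<1-\rho^\ast(\alpha)\}$ - $\mathcal{G}_2=\{0<\alpha<\rho_c^0,\ 1-\rho^\ast(\alpha)<\beta<1\}$ - $\mathcal{G}_3=\{\rho_c^0<\alpha<1-\rho_c^0,\ 1-\rho_c^1<\beta<\rho_c^1\}$ - $\mathcal{G}_4=\{\rho_c^0<\alpha<1-\rho_c^0,\ \rho_c^1<\beta<1\}$ - $\mathcal{G}_5=\{1-\rho_c^0<\alpha<1,\ 1-\rho_c^1<\beta<\rho_c^1\}$ - $\mathcal{G}_6=\{1-\rho_c^0<\alpha<1,\ \rho_c^1<\beta<1\}$ - $\mathcal{G}_7=\{0<\beta<1-\rho_c^1,\ 1-\rho_\ast(\beta)<\alpha<\rho_\ast(\beta)\}$ - $\mathcal{G}_8=\{0<\beta<1-\rho_c^1,\ \rho_\ast(\beta)<\alpha<1\}$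
   Formalization: The remarks that ρ increases or decreases along the reduced flow are not required in the types: with an interior minimum of k, ρ is not monotone on the repelling or attracting branch over [0,1], so types 1, 2, 7, 8 would be empty. Directions of ρ in the layers are required. *)

theory Defs
  imports "HOL-Analysis.Analysis"
begin

type_synonym point = "real \<times> real \<times> real"

text \<open>Points of phase space are triples \<open>(j, \<xi>, \<rho>)\<close>.\<close>

abbreviation j_of :: "point \<Rightarrow> real" where "j_of p \<equiv> fst p"
abbreviation xi_of :: "point \<Rightarrow> real" where "xi_of p \<equiv> fst (snd p)"
abbreviation rho_of :: "point \<Rightarrow> real" where "rho_of p \<equiv> snd (snd p)"

definition crit_mfd :: "point set" where
  "crit_mfd = {(j, \<xi>, \<rho>). j = \<rho> * (1 - \<rho>)}"

definition crit_mfd_attr :: "point set" where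
  "crit_mfd_attr = crit_mfd \<inter> {p. rho_of p > 1/2}"

definition crit_mfd_rep :: "point set" where
  "crit_mfd_rep = crit_mfd \<inter> {p. rho_of p < 1/2}"

definition canard_pt :: "real \<Rightarrow> point" where
  "canard_pt xs = (1/4, xs, 1/2)"

definition canard :: "(real \<Rightarrow> real) \<Rightarrow> real \<Rightarrow> real \<Rightarrow> real" where
  "canard k xs x =
     (if x \<le> xs then (1 + sqrt (1 - k xs / k x)) / 2 else (1 - sqrt (1 - k xs / k x)) / 2)"

text \<open>The restriction of a curve \<open>\<gamma>\<close> to the parameter interval \<open>[a, b]\<close> is a nontrivial segment
  of an orbit of the layer problem, traversed in the direction of the flow: \<open>\<phi>\<close> is a solution
  and \<open>\<tau>\<close> an increasing change of time. The time change lives on the open interval only, so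
  that an end point may be an equilibrium, which is reached in infinite time. In all uses
  \<open>\<gamma>\<close> is continuous, which ties the end points to the orbit.\<close>

definition layer_segment :: "(real \<Rightarrow> point) \<Rightarrow> real \<Rightarrow> real \<Rightarrow> bool" where
  "layer_segment \<gamma> a b \<longleftrightarrow>
     a < b \<and> \<gamma> a \<noteq> \<gamma> b \<and>
     (\<exists>j \<xi> \<tau> \<phi>.
        (\<forall>t\<in>{a..b}. j_of (\<gamma> t) = j \<and> xi_of (\<gamma> t) = \<xi>) \<and>
        continuous_on {a<..<b} \<tau> \<and> strict_mono_on {a<..<b} \<tau> \<and>
        (\<forall>t\<in>{a<..<b}. rho_of (\<gamma> t) = \<phi> (\<tau> t) \<and>
           (\<phi> has_real_derivative \<phi> (\<tau> t) * (1 - \<phi> (\<tau> t)) - j) (at (\<tau> t))))"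

text \<open>As \<open>\<xi>\<close> has unit speed, an orbit of the reduced problem is a graph \<open>\<rho> = r(\<xi>)\<close> over an
  interval \<open>I\<close>. It avoids the fold line, except that it may pass through the canard
  point along the canard.\<close>

definition reduced_orbit ::
    "(real \<Rightarrow> real) \<Rightarrow> (real \<Rightarrow> real) \<Rightarrow> real \<Rightarrow> real set \<Rightarrow> (real \<Rightarrow> real) \<Rightarrow> bool" where
  "reduced_orbit k k' xs I r \<longleftrightarrow>
     I \<subseteq> {0..1} \<and> r ` I \<subseteq> {0..1} \<and>
     (\<forall>x\<in>I. \<exists>r'. (r has_real_derivative r') (at x within I) \<and>
        (1 - 2 * r x) * r' = - (k' x / k x) * r x * (1 - r x)) \<and>
     ((\<forall>x\<in>I. r x > 1/2) \<or> (\<forall>x\<in>I. r x < 1/2) \<or> (\<forall>x\<in>I. r x = canard k xs x))"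

definition reduced_segment ::
    "(real \<Rightarrow> real) \<Rightarrow> (real \<Rightarrow> real) \<Rightarrow> real \<Rightarrow> (real \<Rightarrow> point) \<Rightarrow> real \<Rightarrow> real \<Rightarrow> bool" where
  "reduced_segment k k' xs \<gamma> a b \<longleftrightarrow>
     a < b \<and> \<gamma> ` {a..b} \<subseteq> crit_mfd \<and> strict_mono_on {a..b} (\<lambda>t. xi_of (\<gamma> t)) \<and>
     (\<exists>r. reduced_orbit k k' xs {xi_of (\<gamma> a)..xi_of (\<gamma> b)} r \<and>
          (\<forall>t\<in>{a..b}. rho_of (\<gamma> t) = r (xi_of (\<gamma> t))))"

definition rho_left :: "real \<Rightarrow> real" where
  "rho_left \<alpha> = (if \<alpha> \<le> 1/2 then \<alpha> else 1 - 1 / (4 * \<alpha>))"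

definition rho_right :: "real \<Rightarrow> real" where
  "rho_right \<beta> = (if \<beta> \<le> 1/2 then 1 - \<beta> else 1 / (4 * \<beta>))"

definition left_pts :: "real \<Rightarrow> point set" where
  "left_pts \<alpha> = {(\<alpha> * (1 - s), 0, s) | s. rho_left \<alpha> \<le> s \<and> s \<le> 1}"

definition right_pts :: "real \<Rightarrow> point set" where
  "right_pts \<beta> = {(\<beta> * t, 1, t) | t. 0 \<le> t \<and> t \<le> rho_right \<beta>}"

text \<open>A parametrisation over \<open>[0, 1]\<close> of a singular solution.\<close>

definition singular_path ::
    "(real \<Rightarrow> real) \<Rightarrow> (real \<Rightarrow> real) \<Rightarrow> real \<Rightarrow> real \<Rightarrow> real \<Rightarrow> (real \<Rightarrow> point) \<Rightarrow> bool" where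
  "singular_path k k' xs \<alpha> \<beta> \<gamma> \<longleftrightarrow>
     path \<gamma> \<and> pathstart \<gamma> \<in> left_pts \<alpha> \<and> pathfinish \<gamma> \<in> right_pts \<beta> \<and>
     (\<exists>(n::nat) (t::nat \<Rightarrow> real). t 0 = 0 \<and> t n = 1 \<and>
        (\<forall>i<n. layer_segment \<gamma> (t i) (t (Suc i)) \<or> reduced_segment k k' xs \<gamma> (t i) (t (Suc i))))"

text \<open>In the next two definitions \<open>R\<close> is \<open>(<)\<close> if \<open>\<rho>\<close> increases in the layer and \<open>(>)\<close> if
  it decreases.\<close>

definition layer_at_0 :: "(real \<Rightarrow> real \<Rightarrow> bool) \<Rightarrow> (real \<Rightarrow> point) \<Rightarrow> real \<Rightarrow> bool" where
  "layer_at_0 R \<gamma> a \<longleftrightarrow> layer_segment \<gamma> 0 a \<and> xi_of (\<gamma> a) = 0 \<and> \<gamma> a \<in> crit_mfd \<and>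
     monotone_on {0..a} (<) R (\<lambda>t. rho_of (\<gamma> t))"

definition layer_at_1 :: "(real \<Rightarrow> real \<Rightarrow> bool) \<Rightarrow> (real \<Rightarrow> point) \<Rightarrow> real \<Rightarrow> bool" where
  "layer_at_1 R \<gamma> b \<longleftrightarrow> layer_segment \<gamma> b 1 \<and> xi_of (\<gamma> b) = 1 \<and> \<gamma> b \<in> crit_mfd \<and>
     monotone_on {b..1} (<) R (\<lambda>t. rho_of (\<gamma> t))"

text \<open>The three itineraries behind the eight types. No monotonicity of \<open>\<rho>\<close> is imposed along the
  reduced flow: its sign of change is dictated by \<open>k'\<close>, which changes sign at \<open>xs\<close>.\<close>

definition rep_then_layer ::
    "(real \<Rightarrow> real) \<Rightarrow> (real \<Rightarrow> real) \<Rightarrow> real \<Rightarrow> (real \<Rightarrow> real \<Rightarrow> bool) \<Rightarrow> (real \<Rightarrow> point) \<Rightarrow> bool"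
  where
  "rep_then_layer k k' xs R \<gamma> \<longleftrightarrow>
     (\<exists>b. reduced_segment k k' xs \<gamma> 0 b \<and> \<gamma> ` {0..b} \<subseteq> crit_mfd_rep \<and> layer_at_1 R \<gamma> b)"

definition layer_canard_layer ::
    "(real \<Rightarrow> real) \<Rightarrow> (real \<Rightarrow> real) \<Rightarrow> real \<Rightarrow> (real \<Rightarrow> real \<Rightarrow> bool) \<Rightarrow> (real \<Rightarrow> real \<Rightarrow> bool) \<Rightarrow>
     (real \<Rightarrow> point) \<Rightarrow> bool"
  where
  "layer_canard_layer k k' xs R S \<gamma> \<longleftrightarrow>
     (\<exists>a b. layer_at_0 R \<gamma> a \<and> reduced_segment k k' xs \<gamma> a b \<and>
            canard_pt xs \<in> \<gamma> ` {a..b} \<and> layer_at_1 S \<gamma> b)"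

definition layer_then_attr ::
    "(real \<Rightarrow> real) \<Rightarrow> (real \<Rightarrow> real) \<Rightarrow> real \<Rightarrow> (real \<Rightarrow> real \<Rightarrow> bool) \<Rightarrow> (real \<Rightarrow> point) \<Rightarrow> bool"
  where
  "layer_then_attr k k' xs R \<gamma> \<longleftrightarrow>
     (\<exists>a. layer_at_0 R \<gamma> a \<and> reduced_segment k k' xs \<gamma> a 1 \<and> \<gamma> ` {a..1} \<subseteq> crit_mfd_attr)"

definition has_type ::
    "(real \<Rightarrow> real) \<Rightarrow> (real \<Rightarrow> real) \<Rightarrow> real \<Rightarrow> nat \<Rightarrow> (real \<Rightarrow> point) \<Rightarrow> bool" where
  "has_type k k' xs i \<gamma> \<longleftrightarrow>
     (i = 1 \<and> rep_then_layer k k' xs (<) \<gamma>) \<or>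
     (i = 2 \<and> rep_then_layer k k' xs (>) \<gamma>) \<or>
     (i = 3 \<and> layer_canard_layer k k' xs (<) (<) \<gamma>) \<or>
     (i = 4 \<and> layer_canard_layer k k' xs (<) (>) \<gamma>) \<or>
     (i = 5 \<and> layer_canard_layer k k' xs (>) (<) \<gamma>) \<or>
     (i = 6 \<and> layer_canard_layer k k' xs (>) (>) \<gamma>) \<or>
     (i = 7 \<and> layer_then_attr k k' xs (<) \<gamma>) \<or>
     (i = 8 \<and> layer_then_attr k k' xs (>) \<gamma>)"

text \<open>An oriented curve is a class of paths modulo orientation preserving reparametrisation of
  \<open>[0, 1]\<close>. (A strictly increasing surjection of \<open>[0, 1]\<close> is a homeomorphism, and values of
  paths outside \<open>[0, 1]\<close> are irrelevant.)\<close>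

definition oriented_curve :: "(real \<Rightarrow> point) \<Rightarrow> (real \<Rightarrow> point) set" where
  "oriented_curve \<gamma> =
     {\<delta>. \<exists>h. strict_mono_on {0..1} h \<and> h ` {0..1} = {0..1} \<and> (\<forall>t\<in>{0..1}. \<delta> t = \<gamma> (h t))}"

definition singular_solutions ::
    "(real \<Rightarrow> real) \<Rightarrow> (real \<Rightarrow> real) \<Rightarrow> real \<Rightarrow> real \<Rightarrow> real \<Rightarrow> nat \<Rightarrow> (real \<Rightarrow> point) set set" where
  "singular_solutions k k' xs \<alpha> \<beta> i =
     oriented_curve ` {\<gamma>. singular_path k k' xs \<alpha> \<beta> \<gamma> \<and> has_type k k' xs i \<gamma>}"

definition rho_c0 :: "(real \<Rightarrow> real) \<Rightarrow> real \<Rightarrow> real" where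
  "rho_c0 k xs = (1 - sqrt (1 - k xs / k 0)) / 2"

definition rho_c1 :: "(real \<Rightarrow> real) \<Rightarrow> real \<Rightarrow> real" where
  "rho_c1 k xs = (1 + sqrt (1 - k xs / k 1)) / 2"

definition rho_upper_star :: "(real \<Rightarrow> real) \<Rightarrow> real \<Rightarrow> real" where
  "rho_upper_star k \<alpha> = (1 - sqrt (1 - 4 * \<alpha> * (1 - \<alpha>) * k 0 / k 1)) / 2"

definition rho_lower_star :: "(real \<Rightarrow> real) \<Rightarrow> real \<Rightarrow> real" where
  "rho_lower_star k \<beta> = (1 + sqrt (1 - 4 * \<beta> * (1 - \<beta>) * k 1 / k 0)) / 2"

definition region :: "(real \<Rightarrow> real) \<Rightarrow> real \<Rightarrow> nat \<Rightarrow> (real \<times> real) set" where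
  "region k xs i =
     (let c0 = rho_c0 k xs; c1 = rho_c1 k xs in
      {(\<alpha>, \<beta>).
        (i = 1 \<and> 0 < \<alpha> \<and> \<alpha> < c0 \<and> rho_upper_star k \<alpha> < \<beta> \<and> \<beta> < 1 - rho_upper_star k \<alpha>) \<or>
        (i = 2 \<and> 0 < \<alpha> \<and> \<alpha> < c0 \<and> 1 - rho_upper_star k \<alpha> < \<beta> \<and> \<beta> < 1) \<or>
        (i = 3 \<and> c0 < \<alpha> \<and> \<alpha> < 1 - c0 \<and> 1 - c1 < \<beta> \<and> \<beta> < c1) \<or>
        (i = 4 \<and> c0 < \<alpha> \<and> \<alpha> < 1 - c0 \<and> c1 < \<beta> \<and> \<beta> < 1) \<or>
        (i = 5 \<and> 1 - c0 < \<alpha> \<and> \<alpha> < 1 \<and> 1 - c1 < \<beta> \<and> \<beta> < c1) \<or>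
        (i = 6 \<and> 1 - c0 < \<alpha> \<and> \<alpha> < 1 \<and> c1 < \<beta> \<and> \<beta> < 1) \<or>
        (i = 7 \<and> 0 < \<beta> \<and> \<beta> < 1 - c1 \<and> 1 - rho_lower_star k \<beta> < \<alpha> \<and> \<alpha> < rho_lower_star k \<beta>) \<or>
        (i = 8 \<and> 0 < \<beta> \<and> \<beta> < 1 - c1 \<and> rho_lower_star k \<beta> < \<alpha> \<and> \<alpha> < 1)})"

end

theory Submission
  imports Defs
begin

text \<open>In each of the three itineraries the boundary data single out one reduced orbit \<open>r\<close> over the whole
  of \<open>[0, 1]\<close>: the conserved quantity \<open>k r (1 - r)\<close> fixes it on a branch of the critical manifold, and an
  orbit through the canard point must be the canard. As \<open>j\<close> is constant in a layer, the end point on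
  \<open>left_pts \<alpha>\<close> has height \<open>1 - r 0 (1 - r 0) / \<alpha>\<close>, and the one on \<open>right_pts \<beta>\<close> has height
  \<open>r 1 (1 - r 1) / \<beta>\<close>. The regions say on which side of \<open>r 0\<close> and \<open>r 1\<close> these heights lie and that no
  second equilibrium separates them, so that the layers exist and have the prescribed direction.
  For uniqueness, every curve with this itinerary is monotone in an arc length type coordinate of a
  model curve and is therefore a reparametrisation of it. The canard is differentiable at its
  fold point because \<open>(k x - k xs) / (x - xs)\<^sup>2\<close> converges there.\<close>

section \<open>Oriented curves and layer orbits\<close>

lemma strict_mono_on_concat:
  fixes f :: "real \<Rightarrow> real"
  assumes "strict_mono_on {a..b} f" "strict_mono_on {b..c} f"
  shows "strict_mono_on {a..c} f"
proof (rule strict_mono_onI)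
  fix x y assume xy: "x \<in> {a..c}" "y \<in> {a..c}" "x < y"
  consider "y \<le> b" | "b \<le> x" | "x < b" "b < y" by linarith
  then show "f x < f y"
  proof cases
    case 3
    then have "f x < f b" "f b < f y"
      using xy strict_mono_onD[OF assms(1), of x b] strict_mono_onD[OF assms(2), of b y] by auto
    then show ?thesis by simp
  qed (use xy in \<open>auto intro: strict_mono_onD[OF assms(1)] strict_mono_onD[OF assms(2)]\<close>)
qed

text \<open>Increasing surjections of the unit interval form a group under composition: composing
  with \<open>h\<close> carries one class into the other, composing with its inverse carries it
  back.\<close>

lemma oriented_curve_reparam:
  assumes mono: "strict_mono_on {0..1} h" and surj: "h ` {0..1} = {0..1}"
    and eq: "\<And>t. t \<in> {0..1} \<Longrightarrow> \<gamma> t = \<delta> (h t)"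
  shows "oriented_curve \<gamma> = oriented_curve \<delta>"
proof -
  let ?g = "inv_into {0..1} h"
  have inj: "inj_on h {0..1}"
    using mono by (rule strict_mono_on_imp_inj_on)
  have bij: "bij_betw h {0..1} {0..1}"
    using inj surj by (simp add: bij_betw_def)
  have g_im: "?g ` {0..1} = {0..1}"
    using bij_betw_inv_into[OF bij] by (simp add: bij_betw_def)
  have hg: "h (?g t) = t" if "t \<in> {0..1}" for t
    using surj that by (simp add: f_inv_into_f)
  have g_mono: "strict_mono_on {0..1} ?g"
  proof (rule strict_mono_onI)
    fix x y :: real assume xy: "x \<in> {0..1}" "y \<in> {0..1}" "x < y"
    have "?g x \<in> {0..1}" "?g y \<in> {0..1}" using g_im xy by blast+
    then show "?g x < ?g y"
      using strict_mono_on_less[OF mono, of "?g x" "?g y"] hg xy by auto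
  qed
  have comp: "strict_mono_on {0..1} (f \<circ> f') \<and> (f \<circ> f') ` {0..1} = {0..1::real}"
    if "strict_mono_on {0..1} f" "f ` {0..1} = {0..1}" "strict_mono_on {0..1} f'" "f' ` {0..1} = {0..1}"
    for f f' :: "real \<Rightarrow> real"
  proof
    show "strict_mono_on {0..1} (f \<circ> f')"
      using that unfolding strict_mono_on_def comp_def by (metis imageI)
    show "(f \<circ> f') ` {0..1} = {0..1::real}"
      using that by (metis image_comp)
  qed
  show ?thesis
  proof (intro set_eqI iffI)
    fix \<eta> assume "\<eta> \<in> oriented_curve \<gamma>"
    then obtain f where f: "strict_mono_on {0..1} f" "f ` {0..1} = {0..1}"
      "\<forall>t\<in>{0..1}. \<eta> t = \<gamma> (f t)" unfolding oriented_curve_def by blast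
    have "\<forall>t\<in>{0..1}. \<eta> t = \<delta> ((h \<circ> f) t)"
    proof
      fix t :: real assume t: "t \<in> {0..1}"
      then have "f t \<in> {0..1}" using f(2) by blast
      then show "\<eta> t = \<delta> ((h \<circ> f) t)" using f(3) t eq by simp
    qed
    then show "\<eta> \<in> oriented_curve \<delta>"
      using comp[OF mono surj f(1,2)] unfolding oriented_curve_def by blast
  next
    fix \<eta> assume "\<eta> \<in> oriented_curve \<delta>"
    then obtain f where f: "strict_mono_on {0..1} f" "f ` {0..1} = {0..1}"
      "\<forall>t\<in>{0..1}. \<eta> t = \<delta> (f t)" unfolding oriented_curve_def by blast
    have "\<forall>t\<in>{0..1}. \<eta> t = \<gamma> ((?g \<circ> f) t)"
    proof
      fix t :: real assume t: "t \<in> {0..1}"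
      then have ft: "f t \<in> {0..1}" using f(2) by blast
      then have "?g (f t) \<in> {0..1}" using g_im by blast
      then show "\<eta> t = \<gamma> ((?g \<circ> f) t)" using f(3) t eq hg[OF ft] by simp
    qed
    then show "\<eta> \<in> oriented_curve \<gamma>"
      using comp[OF g_mono g_im f(1,2)] unfolding oriented_curve_def by blast
  qed
qed

text \<open>An increasing surjection of \<open>{0..1}\<close> onto itself fixes 0 and 1, so a
  condition on the end points holds for all representatives of a curve as soon as it holds for
  one.\<close>

lemma oriented_curve_ends:
  assumes "\<delta> \<in> oriented_curve \<gamma>"
  shows "\<delta> 0 = \<gamma> 0" "\<delta> 1 = \<gamma> 1"
proof -
  obtain h where h: "strict_mono_on {0..1} h" "h ` {0..1} = {0..1}"
    and eq: "\<forall>t\<in>{0..1}. \<delta> t = \<gamma> (h t)"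
    using assms unfolding oriented_curve_def by blast
  have mono: "h x \<le> h y" if "x \<in> {0..1}" "y \<in> {0..1}" "x \<le> y" for x y
    using strict_mono_on_leD[OF h(1)] that by blast
  have "0 \<in> h ` {0..1}" "1 \<in> h ` {0..1}" using h(2) by auto
  then obtain x y where xy: "x \<in> {0..1}" "y \<in> {0..1}" "h x = 0" "h y = 1" by (metis imageE)
  have "h 0 \<in> {0..1}" "h 1 \<in> {0..1}" using h(2) by (metis atLeastAtMost_iff imageI order_refl zero_le_one)+
  moreover have "h 0 \<le> 0" "1 \<le> h 1" using mono[of 0 x] mono[of y 1] xy by auto
  ultimately have "h 0 = 0" "h 1 = 1" by auto
  with eq show "\<delta> 0 = \<gamma> 0" "\<delta> 1 = \<gamma> 1" by auto
qed

text \<open>With \<open>j = r (1 - r)\<close> the layer equation factors as \<open>\<phi>' = (\<phi> - r) (1 - r - \<phi>)\<close>, so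
  \<open>q = (\<phi> - r) / (1 - r - \<phi>)\<close> satisfies \<open>q' = (1 - 2 r) q\<close>. The sign of \<open>q\<close> is that of \<open>c\<close>.\<close>

lemma layer_segmentI:
  fixes r c d :: real
  assumes "a < b" "c \<noteq> 0" and r: "r \<noteq> 1/2"
    and line: "\<And>t. t \<in> {a..b} \<Longrightarrow> \<gamma> t = (r * (1 - r), \<xi>, d + c * t)"
    and flow: "\<And>t. t \<in> {a<..<b} \<Longrightarrow> c * ((d + c * t - r) * (1 - r - (d + c * t))) > 0"
  shows "layer_segment \<gamma> a b"
proof -
  define D where "D = 1 - 2 * r"
  define s where "s = sgn c"
  define q where "q t = (d + c * t - r) / (1 - r - (d + c * t))" for t
  \<comment> \<open>Solving \<open>q' = D q\<close> gives \<open>q = s * exp (D * x)\<close>: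
    \<open>\<tau>\<close> is the time read off from this, and \<open>\<phi>\<close> recovers the
    height from \<open>q\<close> by inverting the Moebius map. The factor \<open>s\<close> makes the
    argument of \<open>ln\<close> positive.\<close>
  define \<tau> where "\<tau> t = ln (s * q t) / D" for t
  define \<phi> where "\<phi> x = (r + s * (1 - r) * exp (D * x)) / (1 + s * exp (D * x))" for x
  have D: "D \<noteq> 0" using r by (simp add: D_def)
  have ss: "s * s = 1" using \<open>c \<noteq> 0\<close> by (simp add: s_def sgn_mult_self_eq)
  have nz: "1 - r - (d + c * t) \<noteq> 0" "d + c * t - r \<noteq> 0" if "t \<in> {a<..<b}" for t
    using flow[OF that] by auto
  have pos: "s * q t > 0" if "t \<in> {a<..<b}" for t
    using flow[OF that] unfolding s_def q_def
    by (auto simp: sgn_if zero_less_mult_iff mult_less_0_iff zero_less_divide_iff divide_less_0_iff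
        split: if_splits)
  have deriv_\<tau>: "(\<tau> has_real_derivative c / ((d + c * t - r) * (1 - r - (d + c * t)))) (at t)"
    if t: "t \<in> {a<..<b}" for t
  proof -
    have "(q has_real_derivative c * D / (1 - r - (d + c * t))\<^sup>2) (at t)"
      unfolding q_def using nz[OF t]
      by (auto intro!: derivative_eq_intros simp: D_def field_simps power2_eq_square)
    then have "((\<lambda>t. s * q t) has_real_derivative s * (c * D / (1 - r - (d + c * t))\<^sup>2)) (at t)"
      by (rule DERIV_cmult)
    from DERIV_cdivide[OF DERIV_chain2[OF DERIV_ln[OF pos[OF t]] this], of D]
    have "(\<tau> has_real_derivative s * (c * D / (1 - r - (d + c * t))\<^sup>2) / (s * q t) / D) (at t)"
      unfolding \<tau>_def by (simp only: divide_inverse mult_ac mult_1_left mult_1_right)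
    moreover have "s * (c * D / (1 - r - (d + c * t))\<^sup>2) / (s * q t) / D
        = c / ((d + c * t - r) * (1 - r - (d + c * t)))"
    proof -
      have "s * (c * D / v\<^sup>2) / (s * (u / v)) / D = c / (u * v)" if "u \<noteq> 0" "v \<noteq> 0" for u v
        using that D ss by (auto simp: field_simps power2_eq_square)
      from this[OF nz(2)[OF t] nz(1)[OF t]] show ?thesis unfolding q_def .
    qed
    ultimately show ?thesis by simp
  qed
  have cont: "continuous_on {a<..<b} \<tau>"
    using deriv_\<tau> by (meson DERIV_isCont continuous_at_imp_continuous_on)
  have mono: "strict_mono_on {a<..<b} \<tau>"
  proof (rule strict_mono_onI)
    fix x y assume xy: "x \<in> {a<..<b}" "y \<in> {a<..<b}" "x < y"
    show "\<tau> x < \<tau> y"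
    proof (rule DERIV_pos_imp_increasing[OF xy(3)])
      fix t assume "x \<le> t" "t \<le> y"
      then have t: "t \<in> {a<..<b}" using xy by auto
      \<comment> \<open>The derivative of the time change is the slope of the line divided by the
        layer vector field; \<open>flow\<close> says that both have the same sign, so the line is
        traversed with the flow.\<close>
      have "c / ((d + c * t - r) * (1 - r - (d + c * t))) > 0"
        using flow[OF t] by (auto simp: zero_less_mult_iff zero_less_divide_iff)
      then show "\<exists>y. DERIV \<tau> t :> y \<and> 0 < y" using deriv_\<tau>[OF t] by blast
    qed
  qed
  have sol: "d + c * t = \<phi> (\<tau> t) \<and>
      (\<phi> has_real_derivative \<phi> (\<tau> t) * (1 - \<phi> (\<tau> t)) - r * (1 - r)) (at (\<tau> t))"
    if t: "t \<in> {a<..<b}" for t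
  proof -
    have "exp (D * \<tau> t) = s * q t" using D pos[OF t] by (simp add: \<tau>_def)
    then have E: "s * exp (D * \<tau> t) = q t" using ss by (metis mult.assoc mult_1)
    have one_q: "1 + q t = D / (1 - r - (d + c * t))"
      unfolding q_def D_def using nz[OF t] by (simp add: field_simps)
    then have q1: "1 + q t \<noteq> 0" using nz[OF t] D by simp
    have "\<phi> (\<tau> t) = (r + (1 - r) * (s * exp (D * \<tau> t))) / (1 + s * exp (D * \<tau> t))"
      unfolding \<phi>_def by (simp add: algebra_simps)
    also have "\<dots> = (r + (1 - r) * q t) / (1 + q t)" by (simp only: E)
    also have "\<dots> = d + c * t"
    proof -
      have "r + (1 - r) * q t = (d + c * t) * (1 + q t)"
        unfolding one_q using nz[OF t] by (simp add: q_def D_def field_simps)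
      then show ?thesis using q1 by simp
    qed
    finally have val: "\<phi> (\<tau> t) = d + c * t" .
    \<comment> \<open>For \<open>s = -1\<close> the formula for \<open>\<phi>\<close> has a pole at
      time 0. The derivative is taken only at the times \<open>\<tau> t\<close>, where the
      denominator equals \<open>1 + q t\<close> and does not vanish.\<close>
    have E1: "1 + s * exp (D * \<tau> t) \<noteq> 0" using q1 E by simp
    have "(\<phi> has_real_derivative
       ((s * (1 - r) * (exp (D * \<tau> t) * D)) * (1 + s * exp (D * \<tau> t)) -
        (r + s * (1 - r) * exp (D * \<tau> t)) * (s * (exp (D * \<tau> t) * D))) /
        ((1 + s * exp (D * \<tau> t)) * (1 + s * exp (D * \<tau> t)))) (at (\<tau> t))"
      unfolding \<phi>_def using E1 by (auto intro!: derivative_eq_intros)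
    also have "((s * (1 - r) * (exp (D * \<tau> t) * D)) * (1 + s * exp (D * \<tau> t)) -
        (r + s * (1 - r) * exp (D * \<tau> t)) * (s * (exp (D * \<tau> t) * D)))
      = ((1 - r) * (1 + s * exp (D * \<tau> t)) - (r + (1 - r) * (s * exp (D * \<tau> t)))) * (s * exp (D * \<tau> t)) * D"
      by (simp add: algebra_simps)
    also have "\<dots> = D * D * q t" unfolding E by (simp add: D_def algebra_simps)
    also have "D * D * q t / ((1 + s * exp (D * \<tau> t)) * (1 + s * exp (D * \<tau> t)))
      = (d + c * t - r) * (1 - r - (d + c * t))"
    proof -
      have "D * D * (u / v) / (D / v * (D / v)) = u * v" if "v \<noteq> 0" for u v
        using that D by simp
      from this[OF nz(1)[OF t]] show ?thesis unfolding E one_q unfolding q_def .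
    qed
    also have "\<dots> = (d + c * t) * (1 - (d + c * t)) - r * (1 - r)" by (simp add: algebra_simps)
    finally show ?thesis using val by simp
  qed
  have "\<gamma> a \<noteq> \<gamma> b" using line[of a] line[of b] \<open>a < b\<close> \<open>c \<noteq> 0\<close> by auto
  moreover have "\<forall>t\<in>{a..b}. j_of (\<gamma> t) = r * (1 - r) \<and> xi_of (\<gamma> t) = \<xi>"
    using line by auto
  moreover have "\<forall>t\<in>{a<..<b}. rho_of (\<gamma> t) = \<phi> (\<tau> t) \<and>
      (\<phi> has_real_derivative \<phi> (\<tau> t) * (1 - \<phi> (\<tau> t)) - r * (1 - r)) (at (\<tau> t))"
    using line sol by auto
  ultimately show ?thesis unfolding layer_segment_def using \<open>a < b\<close> cont mono by blast
qed

section \<open>The model curve over a reduced orbit\<close>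

definition clamp01 :: "real \<Rightarrow> real" where
  "clamp01 u = max 0 (min 1 u)"

text \<open>The coordinate \<open>u\<close> is \<open>\<xi>\<close> along the graph of \<open>r\<close>; for \<open>u \<le> 0\<close> and \<open>u \<ge> 1\<close> it measures \<open>\<rho>\<close> in the
  layers from height \<open>s\<close> to \<open>r 0\<close> and from \<open>r 1\<close> to height \<open>t\<close>. A missing layer (\<open>s = r 0\<close> or
  \<open>t = r 1\<close>) is covered because then \<open>sgn\<close> vanishes.\<close>

definition arc_point :: "real \<Rightarrow> (real \<Rightarrow> real) \<Rightarrow> real \<Rightarrow> real \<Rightarrow> point" where
  "arc_point s r t u =
     (r (clamp01 u) * (1 - r (clamp01 u)), clamp01 u,
      r (clamp01 u) + sgn (r 0 - s) * min u 0 + sgn (t - r 1) * max (u - 1) 0)"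

text \<open>Length of the range of \<open>u\<close>, which runs from
  \<open>- \<bar>r 0 - s\<bar>\<close> to \<open>1 + \<bar>t - r 1\<bar>\<close>; the reduced part
  contributes 1 because it is measured by \<xi>.\<close>

definition arc_length :: "real \<Rightarrow> (real \<Rightarrow> real) \<Rightarrow> real \<Rightarrow> real" where
  "arc_length s r t = \<bar>r 0 - s\<bar> + 1 + \<bar>t - r 1\<bar>"

definition sing_arc :: "real \<Rightarrow> (real \<Rightarrow> real) \<Rightarrow> real \<Rightarrow> real \<Rightarrow> point" where
  "sing_arc s r t x = arc_point s r t (arc_length s r t * x - \<bar>r 0 - s\<bar>)"

text \<open>The parameter of \<open>sing_arc\<close> where \<open>u = 0\<close>;
  \<open>arc_out\<close> is the one where \<open>u = 1\<close>.\<close>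

definition arc_in :: "real \<Rightarrow> (real \<Rightarrow> real) \<Rightarrow> real \<Rightarrow> real" where
  "arc_in s r t = \<bar>r 0 - s\<bar> / arc_length s r t"

definition arc_out :: "real \<Rightarrow> (real \<Rightarrow> real) \<Rightarrow> real \<Rightarrow> real" where
  "arc_out s r t = (\<bar>r 0 - s\<bar> + 1) / arc_length s r t"

lemma arc_length_pos: "arc_length s r t > 0"
  by (simp add: arc_length_def)

text \<open>The reduced part has length 1 in \<open>u\<close>, so the two break points never
  coincide; a layer shrinks to a single parameter exactly when the heights it should join
  agree.\<close>

lemma arc_breaks: "0 \<le> arc_in s r t" "arc_in s r t < arc_out s r t" "arc_out s r t \<le> 1"
  "arc_in s r t = 0 \<longleftrightarrow> s = r 0" "arc_out s r t = 1 \<longleftrightarrow> t = r 1"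
proof -
  have N: "arc_length s r t > 0" by (rule arc_length_pos)
  have eq: "arc_length s r t = \<bar>r 0 - s\<bar> + 1 + \<bar>t - r 1\<bar>" by (rule arc_length_def)
  show "0 \<le> arc_in s r t" using N by (simp add: arc_in_def)
  show "arc_in s r t < arc_out s r t" using N by (simp add: arc_in_def arc_out_def divide_strict_right_mono)
  show "arc_out s r t \<le> 1" using N eq by (simp add: arc_out_def divide_le_eq_1)
  show "arc_in s r t = 0 \<longleftrightarrow> s = r 0" using N by (auto simp: arc_in_def)
  have "arc_out s r t = 1 \<longleftrightarrow> \<bar>r 0 - s\<bar> + 1 = arc_length s r t"
    using N by (auto simp: arc_out_def divide_eq_1_iff)
  then show "arc_out s r t = 1 \<longleftrightarrow> t = r 1" using eq by auto
qed

text \<open>\<open>clamp01\<close> keeps the argument of \<open>r\<close> in \<open>{0..1}\<close>,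
  the only place where \<open>r\<close> is known to be continuous.\<close>

lemma path_arc:
  assumes "continuous_on {0..1} r"
  shows "path (sing_arc s r t)"
proof -
  have 1: "continuous_on {0..1} (\<lambda>x. clamp01 (arc_length s r t * x - \<bar>r 0 - s\<bar>))"
    unfolding clamp01_def by (intro continuous_intros)
  have 2: "continuous_on {0..1} (\<lambda>x. r (clamp01 (arc_length s r t * x - \<bar>r 0 - s\<bar>)))"
    by (rule continuous_on_compose2[OF assms 1]) (auto simp: clamp01_def)
  show ?thesis
    unfolding path_def sing_arc_def arc_point_def by (intro continuous_intros 1 2)
qed

text \<open>Here \<open>clamp01\<close> is constantly 0 and what is left is affine in
  \<open>x\<close>, the form expected by \<open>layer_segmentI\<close>. The sign of the slope is the
  direction of the layer.\<close>

lemma arc_layer_0: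
  assumes "x \<in> {0..arc_in s r t}"
  shows "sing_arc s r t x = (r 0 * (1 - r 0), 0, s + sgn (r 0 - s) * arc_length s r t * x)"
proof -
  have le: "arc_length s r t * x \<le> \<bar>r 0 - s\<bar>"
    using assms arc_length_pos[of s r t] by (simp add: arc_in_def field_simps)
  have "sgn (r 0 - s) * \<bar>r 0 - s\<bar> = r 0 - s"
    by (simp add: sgn_mult_abs)
  then show ?thesis
    using le by (simp add: sing_arc_def arc_point_def clamp01_def min_def max_def algebra_simps)
qed

lemma arc_middle:
  assumes "x \<in> {arc_in s r t..arc_out s r t}"
  shows "sing_arc s r t x = (r (arc_length s r t * x - \<bar>r 0 - s\<bar>) * (1 - r (arc_length s r t * x - \<bar>r 0 - s\<bar>)),
    arc_length s r t * x - \<bar>r 0 - s\<bar>, r (arc_length s r t * x - \<bar>r 0 - s\<bar>))"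
    and "arc_length s r t * x - \<bar>r 0 - s\<bar> \<in> {0..1}"
proof -
  have "\<bar>r 0 - s\<bar> \<le> arc_length s r t * x" "arc_length s r t * x \<le> \<bar>r 0 - s\<bar> + 1"
    using assms arc_length_pos[of s r t] by (simp_all add: arc_in_def arc_out_def field_simps)
  moreover define u where "u = arc_length s r t * x - \<bar>r 0 - s\<bar>"
  ultimately have u: "0 \<le> u" "u \<le> 1" by linarith+
  then have c: "clamp01 u = u" "min u 0 = 0" "max (u - 1) 0 = 0"
    by (auto simp: clamp01_def)
  have "sing_arc s r t x = (r u * (1 - r u), u, r u)" "u \<in> {0..1}"
    unfolding sing_arc_def u_def[symmetric] arc_point_def c using u by auto
  then show "arc_length s r t * x - \<bar>r 0 - s\<bar> \<in> {0..1}"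
    and "sing_arc s r t x = (r (arc_length s r t * x - \<bar>r 0 - s\<bar>) * (1 - r (arc_length s r t * x - \<bar>r 0 - s\<bar>)),
    arc_length s r t * x - \<bar>r 0 - s\<bar>, r (arc_length s r t * x - \<bar>r 0 - s\<bar>))"
    unfolding u_def by blast+
qed

lemma arc_layer_1:
  assumes "x \<in> {arc_out s r t..1}"
  shows "sing_arc s r t x = (r 1 * (1 - r 1), 1,
    t - sgn (t - r 1) * arc_length s r t + sgn (t - r 1) * arc_length s r t * x)"
proof -
  have le: "arc_length s r t * x \<ge> \<bar>r 0 - s\<bar> + 1"
    using assms arc_length_pos[of s r t] by (simp add: arc_out_def field_simps)
  define u where "u = arc_length s r t * x - \<bar>r 0 - s\<bar>"
  have "clamp01 u = 1" "min u 0 = 0" "max (u - 1) 0 = u - 1"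
    using le by (auto simp: clamp01_def u_def)
  then have "sing_arc s r t x = (r 1 * (1 - r 1), 1, r 1 + sgn (t - r 1) * (u - 1))"
    by (simp add: sing_arc_def arc_point_def u_def[symmetric])
  moreover have "sgn (t - r 1) * (u - 1) = sgn (t - r 1) * arc_length s r t * x
      - sgn (t - r 1) * arc_length s r t + sgn (t - r 1) * \<bar>t - r 1\<bar>"
  proof -
    have "u - 1 = arc_length s r t * x - arc_length s r t + \<bar>t - r 1\<bar>"
      unfolding u_def using arc_length_def[of s r t] by linarith
    then show ?thesis by (simp only: distrib_left right_diff_distrib mult.assoc)
  qed
  ultimately show ?thesis by (simp add: sgn_mult_abs)
qed

lemma arc_start: "sing_arc s r t 0 = (r 0 * (1 - r 0), 0, s)"
  using arc_layer_0[of 0 s r t] arc_breaks(1)[of s r t] by simp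

lemma arc_finish: "sing_arc s r t 1 = (r 1 * (1 - r 1), 1, t)"
  using arc_layer_1[of 1 s r t] arc_breaks(3)[of s r t] by simp

lemma arc_at_in: "sing_arc s r t (arc_in s r t) = (r 0 * (1 - r 0), 0, r 0)"
  using arc_middle[of "arc_in s r t" s r t] arc_breaks(2)[of s r t] arc_length_pos[of s r t]
  by (simp add: arc_in_def)

lemma arc_at_out: "sing_arc s r t (arc_out s r t) = (r 1 * (1 - r 1), 1, r 1)"
  using arc_middle[of "arc_out s r t" s r t] arc_breaks(2)[of s r t] arc_length_pos[of s r t]
  by (simp add: arc_out_def)

lemma arc_reduced_segment:
  assumes "reduced_orbit k k' xs {0..1} r"
  shows "reduced_segment k k' xs (sing_arc s r t) (arc_in s r t) (arc_out s r t)"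
proof -
  have "strict_mono_on {arc_in s r t..arc_out s r t} (\<lambda>x. xi_of (sing_arc s r t x))"
    by (rule strict_mono_onI) (simp add: arc_middle(1) arc_length_pos)
  moreover have "sing_arc s r t ` {arc_in s r t..arc_out s r t} \<subseteq> crit_mfd"
    by (auto simp: arc_middle(1) crit_mfd_def simp del: atLeastAtMost_iff)
  moreover have "\<forall>x\<in>{arc_in s r t..arc_out s r t}.
      rho_of (sing_arc s r t x) = r (xi_of (sing_arc s r t x))"
    by (simp add: arc_middle(1) del: atLeastAtMost_iff)
  moreover have "reduced_orbit k k' xs
      {xi_of (sing_arc s r t (arc_in s r t))..xi_of (sing_arc s r t (arc_out s r t))} r"
    using assms by (simp add: arc_at_in arc_at_out)
  ultimately show ?thesis
    unfolding reduced_segment_def using arc_breaks(2) by blast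
qed

section \<open>Layers of the model curve\<close>

lemma monotone_on_line:
  fixes c d :: real
  assumes "\<And>x. x \<in> A \<Longrightarrow> f x = d + c * x"
  shows "c > 0 \<Longrightarrow> monotone_on A (<) (<) f" "c < 0 \<Longrightarrow> monotone_on A (<) (>) f"
  unfolding monotone_on_def by (simp_all add: assms)

text \<open>The layer flow with flux \<open>r 0 * (1 - r 0)\<close> has the attracting equilibrium
  \<open>r 0\<close> and the repelling one \<open>1 - r 0\<close>. By \<open>s \<ge> 1 - r 0\<close>
  no equilibrium lies strictly between \<open>s\<close> and \<open>r 0\<close>, and the orbit in
  between runs towards \<open>r 0\<close>; for \<open>s = 1 - r 0\<close> it is the whole
  heteroclinic orbit.\<close>

lemma arc_layer_at_0:
  assumes "s \<noteq> r 0" "r 0 > 1/2" "s \<ge> 1 - r 0"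
  shows "layer_segment (sing_arc s r t) 0 (arc_in s r t)"
    and "s < r 0 \<Longrightarrow> layer_at_0 (<) (sing_arc s r t) (arc_in s r t)"
    and "s > r 0 \<Longrightarrow> layer_at_0 (>) (sing_arc s r t) (arc_in s r t)"
proof -
  let ?N = "arc_length s r t" and ?a = "arc_in s r t"
  let ?c = "sgn (r 0 - s) * ?N"
  have N: "?N > 0" by (rule arc_length_pos)
  have a: "0 < ?a" using arc_breaks(1,4)[of s r t] assms(1) by linarith
  have c: "?c \<noteq> 0" using N assms(1) by (simp add: sgn_eq_0_iff)
  have flow: "?c * ((s + ?c * x - r 0) * (1 - r 0 - (s + ?c * x))) > 0" if x: "x \<in> {0<..<?a}" for x
  proof -
    have x2: "0 < ?N * x" "?N * x < \<bar>r 0 - s\<bar>"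
      using x N by (auto simp: arc_in_def field_simps)
    show ?thesis
    proof (cases "s < r 0")
      case True
      then have "s + ?N * x - r 0 < 0" "1 - r 0 - (s + ?N * x) < 0" using x2 assms by linarith+
      then have "?N * ((s + ?N * x - r 0) * (1 - r 0 - (s + ?N * x))) > 0"
        using N by (intro mult_pos_pos mult_neg_neg)
      then show ?thesis using True by simp
    next
      case False
      then have "s > r 0" using assms(1) by simp
      moreover from this have "s - ?N * x - r 0 > 0" "1 - r 0 - (s - ?N * x) < 0"
        using x2 assms by linarith+
      then have "- ?N * ((s - ?N * x - r 0) * (1 - r 0 - (s - ?N * x))) > 0"
        using N by (intro mult_neg_neg mult_pos_neg) auto
      ultimately show ?thesis by simp
    qed
  qed
  show seg: "layer_segment (sing_arc s r t) 0 ?a"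
  proof (rule layer_segmentI[OF a c _ _ flow])
    show "r 0 \<noteq> 1/2" using assms(2) by simp
  qed (rule arc_layer_0)
  have line: "rho_of (sing_arc s r t x) = s + ?c * x" if "x \<in> {0..?a}" for x
    using arc_layer_0[OF that] by simp
  have base: "xi_of (sing_arc s r t ?a) = 0" "sing_arc s r t ?a \<in> crit_mfd"
    by (simp_all add: arc_at_in crit_mfd_def)
  show "s < r 0 \<Longrightarrow> layer_at_0 (<) (sing_arc s r t) ?a"
    unfolding layer_at_0_def using seg base monotone_on_line(1)[of "{0..?a}", OF line] N by simp
  show "s > r 0 \<Longrightarrow> layer_at_0 (>) (sing_arc s r t) ?a"
    unfolding layer_at_0_def using seg base monotone_on_line(2)[of "{0..?a}", OF line] N by simp
qed

text \<open>Mirror image of the entry layer: the orbit now leaves the repelling equilibrium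
  \<open>r 1\<close>, and \<open>t \<le> 1 - r 1\<close> keeps it from running past the attracting
  one.\<close>

lemma arc_layer_at_1:
  assumes "t \<noteq> r 1" "r 1 < 1/2" "t \<le> 1 - r 1"
  shows "layer_segment (sing_arc s r t) (arc_out s r t) 1"
    and "t > r 1 \<Longrightarrow> layer_at_1 (<) (sing_arc s r t) (arc_out s r t)"
    and "t < r 1 \<Longrightarrow> layer_at_1 (>) (sing_arc s r t) (arc_out s r t)"
proof -
  let ?N = "arc_length s r t" and ?b = "arc_out s r t"
  let ?c = "sgn (t - r 1) * ?N" and ?d = "t - sgn (t - r 1) * arc_length s r t"
  have N: "?N > 0" by (rule arc_length_pos)
  have b: "?b < 1" using arc_breaks(3,5)[of s r t] assms(1) by linarith
  have c: "?c \<noteq> 0" using N assms(1) by (simp add: sgn_eq_0_iff)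
  have flow: "?c * ((?d + ?c * x - r 1) * (1 - r 1 - (?d + ?c * x))) > 0" if x: "x \<in> {?b<..<1}" for x
  proof -
    have x2: "?N * x < ?N" "?N * x > ?N - \<bar>t - r 1\<bar>"
    proof -
      have "?N * ?b = ?N - \<bar>t - r 1\<bar>"
        using N by (simp add: arc_out_def) (simp add: arc_length_def)
      moreover have "?N * ?b < ?N * x" "?N * x < ?N * 1"
        using x N by (simp_all only: mult_less_cancel_left_pos) auto
      ultimately show "?N * x < ?N" "?N * x > ?N - \<bar>t - r 1\<bar>" by simp_all
    qed
    show ?thesis
    proof (cases "t > r 1")
      case True
      then have "t - ?N + ?N * x - r 1 > 0" "1 - r 1 - (t - ?N + ?N * x) > 0"
        using x2 assms by linarith+
      then have "?N * ((t - ?N + ?N * x - r 1) * (1 - r 1 - (t - ?N + ?N * x))) > 0"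
        using N by (intro mult_pos_pos)
      then show ?thesis using True by simp
    next
      case False
      then have "t < r 1" using assms(1) by simp
      moreover from this have "t + ?N - ?N * x - r 1 < 0" "1 - r 1 - (t + ?N - ?N * x) > 0"
        using x2 assms by linarith+
      then have "- ?N * ((t + ?N - ?N * x - r 1) * (1 - r 1 - (t + ?N - ?N * x))) > 0"
        using N by (intro mult_neg_neg mult_neg_pos) auto
      ultimately show ?thesis by simp
    qed
  qed
  show seg: "layer_segment (sing_arc s r t) ?b 1"
  proof (rule layer_segmentI[OF b c _ _ flow])
    show "r 1 \<noteq> 1/2" using assms(2) by simp
  qed (rule arc_layer_1)
  have line: "rho_of (sing_arc s r t x) = ?d + ?c * x" if "x \<in> {?b..1}" for x
    using arc_layer_1[OF that] by simp
  have base: "xi_of (sing_arc s r t ?b) = 1" "sing_arc s r t ?b \<in> crit_mfd"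
    by (simp_all add: arc_at_out crit_mfd_def)
  show "t > r 1 \<Longrightarrow> layer_at_1 (<) (sing_arc s r t) ?b"
    unfolding layer_at_1_def using seg base monotone_on_line(1)[of "{?b..1}", OF line] N by simp
  show "t < r 1 \<Longrightarrow> layer_at_1 (>) (sing_arc s r t) ?b"
    unfolding layer_at_1_def using seg base monotone_on_line(2)[of "{?b..1}", OF line] N by simp
qed

section \<open>Assembly into singular paths, and uniqueness up to reparametrisation\<close>

lemma singular_pathI:
  assumes "path \<gamma>" "pathstart \<gamma> \<in> left_pts \<alpha>" "pathfinish \<gamma> \<in> right_pts \<beta>"
    and "a = 0 \<or> layer_segment \<gamma> 0 a" "reduced_segment k k' xs \<gamma> a b" "b = 1 \<or> layer_segment \<gamma> b 1"
  shows "singular_path k k' xs \<alpha> \<beta> \<gamma>"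
proof -
  let ?good = "\<lambda>t i. layer_segment \<gamma> (t i) (t (Suc i)) \<or> reduced_segment k k' xs \<gamma> (t i) (t (Suc i))"
  have "\<exists>(n::nat) (t::nat \<Rightarrow> real). t 0 = 0 \<and> t n = 1 \<and> (\<forall>i<n. ?good t i)"
  proof -
    \<comment> \<open>The partition has one, two or three pieces according to which layers are
      present; its break points are listed and read off with \<open>!\<close>.\<close>
    consider "a = 0" "b = 1" | "a = 0" "layer_segment \<gamma> b 1" | "layer_segment \<gamma> 0 a" "b = 1"
      | "layer_segment \<gamma> 0 a" "layer_segment \<gamma> b 1" using assms(4,6) by blast
    then show ?thesis
    proof cases
      case 1
      then show ?thesis using assms(5)
        by (intro exI[of _ 1] exI[of _ "\<lambda>i. [0,1] ! i"]) auto
    next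
      case 2
      then show ?thesis using assms(5)
        by (intro exI[of _ 2] exI[of _ "\<lambda>i. [0,b,1] ! i"]) (simp add: numeral_2_eq_2 All_less_Suc)
    next
      case 3
      then show ?thesis using assms(5)
        by (intro exI[of _ 2] exI[of _ "\<lambda>i. [0,a,1] ! i"]) (simp add: numeral_2_eq_2 All_less_Suc)
    next
      case 4
      then show ?thesis using assms(5)
        by (intro exI[of _ 3] exI[of _ "\<lambda>i. [0,a,b,1] ! i"]) (simp add: numeral_3_eq_3 All_less_Suc)
    qed
  qed
  then show ?thesis using assms unfolding singular_path_def by blast
qed

text \<open>The common shape of all curves to be compared with the model curve over
  \<open>r\<close>. A missing layer at the left or right end appears as \<open>a = 0\<close> or
  \<open>b = 1\<close>.\<close>

definition follows_orbit :: "(real \<Rightarrow> real) \<Rightarrow> (real \<Rightarrow> point) \<Rightarrow> real \<Rightarrow> real \<Rightarrow> bool" where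
  "follows_orbit r \<gamma> a b \<longleftrightarrow> 0 \<le> a \<and> a < b \<and> b \<le> 1 \<and>
     (\<forall>x\<in>{a..b}. \<gamma> x = (r (xi_of (\<gamma> x)) * (1 - r (xi_of (\<gamma> x))), xi_of (\<gamma> x), r (xi_of (\<gamma> x)))) \<and>
     strict_mono_on {a..b} (\<lambda>x. xi_of (\<gamma> x)) \<and> xi_of (\<gamma> a) = 0 \<and> xi_of (\<gamma> b) = 1 \<and>
     (a = 0 \<or> layer_at_0 (<) \<gamma> a \<or> layer_at_0 (>) \<gamma> a) \<and>
     (b = 1 \<or> layer_at_1 (<) \<gamma> b \<or> layer_at_1 (>) \<gamma> b)"

lemma layer_segment_const:
  assumes "layer_segment \<gamma> a b" "x \<in> {a..b}" "y \<in> {a..b}"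
  shows "j_of (\<gamma> x) = j_of (\<gamma> y)" "xi_of (\<gamma> x) = xi_of (\<gamma> y)"
  using assms unfolding layer_segment_def by metis+

text \<open>The coordinate \<open>u\<close> can be recovered from any such curve: a signed height in
  the layers, \<xi> in between. It increases strictly and continuously along the curve, so after
  rescaling it is an increasing surjection of \<open>{0..1}\<close> through which the curve factors
  over \<open>sing_arc\<close>.\<close>

lemma oriented_curve_eq_sing_arc:
  assumes "path \<gamma>" and start: "\<gamma> 0 = (r 0 * (1 - r 0), 0, s)" and finish: "\<gamma> 1 = (r 1 * (1 - r 1), 1, t)"
    and fol: "follows_orbit r \<gamma> a b"
  shows "oriented_curve \<gamma> = oriented_curve (sing_arc s r t)"
proof -
  have ab: "0 \<le> a" "a < b" "b \<le> 1"
    and mid: "\<And>x. x \<in> {a..b} \<Longrightarrow> \<gamma> x = (r (xi_of (\<gamma> x)) * (1 - r (xi_of (\<gamma> x))), xi_of (\<gamma> x), r (xi_of (\<gamma> x)))"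
    and xi_mono: "strict_mono_on {a..b} (\<lambda>x. xi_of (\<gamma> x))"
    and xi_a: "xi_of (\<gamma> a) = 0" and xi_b: "xi_of (\<gamma> b) = 1"
    and in0: "a = 0 \<or> layer_at_0 (<) \<gamma> a \<or> layer_at_0 (>) \<gamma> a"
    and out1: "b = 1 \<or> layer_at_1 (<) \<gamma> b \<or> layer_at_1 (>) \<gamma> b"
    using fol unfolding follows_orbit_def by auto
  let ?\<rho> = "\<lambda>x. rho_of (\<gamma> x)"
  let ?\<sigma> = "sgn (r 0 - s)" and ?\<sigma>' = "sgn (t - r 1)" and ?N = "arc_length s r t"
  have N: "?N > 0" by (rule arc_length_pos)
  have \<gamma>a: "\<gamma> a = (r 0 * (1 - r 0), 0, r 0)" using mid[of a] xi_a ab by simp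
  have \<gamma>b: "\<gamma> b = (r 1 * (1 - r 1), 1, r 1)" using mid[of b] xi_b ab by simp
  have lay0: "\<gamma> x = (r 0 * (1 - r 0), 0, ?\<rho> x)" if "x \<in> {0..a}" for x
  proof (cases "a = 0")
    case False
    then have "layer_segment \<gamma> 0 a" using in0 unfolding layer_at_0_def by blast
    then have "j_of (\<gamma> x) = j_of (\<gamma> a)" "xi_of (\<gamma> x) = xi_of (\<gamma> a)"
      using layer_segment_const that ab by (metis atLeastAtMost_iff order_refl)+
    then show ?thesis using \<gamma>a by (simp add: prod_eq_iff)
  qed (use that start in auto)
  have lay1: "\<gamma> x = (r 1 * (1 - r 1), 1, ?\<rho> x)" if "x \<in> {b..1}" for x
  proof (cases "b = 1")
    case False
    then have "layer_segment \<gamma> b 1" using out1 unfolding layer_at_1_def by blast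
    then have "j_of (\<gamma> x) = j_of (\<gamma> b)" "xi_of (\<gamma> x) = xi_of (\<gamma> b)"
      using layer_segment_const that ab by (metis atLeastAtMost_iff order_refl)+
    then show ?thesis using \<gamma>b by (simp add: prod_eq_iff)
  qed (use that finish in auto)
  \<comment> \<open>The layer ends at height \<open>r 0\<close>, so the sign of
    \<open>r 0 - s\<close> decides whether it rises or falls; multiplying by that sign makes it
    increasing in both cases.\<close>
  have mono0: "strict_mono_on {0..a} (\<lambda>x. ?\<sigma> * (?\<rho> x - r 0))"
  proof (cases "a = 0")
    case False
    then have a: "0 < a" using ab by simp
    have "monotone_on {0..a} (<) (<) ?\<rho> \<or> monotone_on {0..a} (<) (>) ?\<rho>"
      using False in0 unfolding layer_at_0_def by blast
    moreover have ?thesis if m: "monotone_on {0..a} (<) (<) ?\<rho>"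
    proof -
      have "s < r 0" using monotone_onD[OF m, of 0 a] a start \<gamma>a by simp
      then show ?thesis using m by (auto simp: monotone_on_def)
    qed
    moreover have ?thesis if m: "monotone_on {0..a} (<) (>) ?\<rho>"
    proof -
      have "s > r 0" using monotone_onD[OF m, of 0 a] a start \<gamma>a by simp
      then show ?thesis using m by (auto simp: monotone_on_def)
    qed
    ultimately show ?thesis by blast
  qed (auto simp: monotone_on_def)
  have mono1: "strict_mono_on {b..1} (\<lambda>x. ?\<sigma>' * (?\<rho> x - r 1))"
  proof (cases "b = 1")
    case False
    then have b: "b < 1" using ab by simp
    have "monotone_on {b..1} (<) (<) ?\<rho> \<or> monotone_on {b..1} (<) (>) ?\<rho>"
      using False out1 unfolding layer_at_1_def by blast
    moreover have ?thesis if m: "monotone_on {b..1} (<) (<) ?\<rho>"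
    proof -
      have "t > r 1" using monotone_onD[OF m, of b 1] b finish \<gamma>b by simp
      then show ?thesis using m by (auto simp: monotone_on_def)
    qed
    moreover have ?thesis if m: "monotone_on {b..1} (<) (>) ?\<rho>"
    proof -
      have "t < r 1" using monotone_onD[OF m, of b 1] b finish \<gamma>b by simp
      then show ?thesis using m by (auto simp: monotone_on_def)
    qed
    ultimately show ?thesis by blast
  qed (auto simp: monotone_on_def)

  \<comment> \<open>\<open>H\<close> is the coordinate of \<open>sing_arc\<close>; clamping the arguments makes it visibly continuous.\<close>
  define H where "H x = ?\<sigma> * (?\<rho> (min x a) - r 0) + xi_of (\<gamma> x) + ?\<sigma>' * (?\<rho> (max x b) - r 1)" for x
  have H0: "H x = ?\<sigma> * (?\<rho> x - r 0)" if "x \<in> {0..a}" for x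
    using that ab arg_cong[OF lay0[OF that], of xi_of] \<gamma>b by (simp add: H_def min_absorb1 max_absorb2)
  have Hmid: "H x = xi_of (\<gamma> x)" if "x \<in> {a..b}" for x
    using that \<gamma>a \<gamma>b by (simp add: H_def min_absorb2 max_absorb2)
  have H1: "H x = 1 + ?\<sigma>' * (?\<rho> x - r 1)" if "x \<in> {b..1}" for x
    using that ab arg_cong[OF lay1[OF that], of xi_of] \<gamma>a by (simp add: H_def min_absorb2 max_absorb1)
  have m0: "strict_mono_on {0..a} H"
    using mono0 by (simp add: monotone_on_def H0)
  have m: "strict_mono_on {a..b} H"
    using xi_mono by (simp add: monotone_on_def Hmid)
  have m1: "strict_mono_on {b..1} H"
    using mono1 by (simp add: monotone_on_def H1)
  have H_mono: "strict_mono_on {0..1} H"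
    using strict_mono_on_concat[OF strict_mono_on_concat[OF m0 m] m1] .
  have cont\<gamma>: "continuous_on {0..1} \<gamma>" using \<open>path \<gamma>\<close> by (simp add: path_def)
  have "continuous_on {0..1} (\<lambda>x. \<gamma> (min x a))" "continuous_on {0..1} (\<lambda>x. \<gamma> (max x b))"
    by (rule continuous_on_compose2[OF cont\<gamma>]; use ab in \<open>auto intro!: continuous_intros\<close>)+
  then have H_cont: "continuous_on {0..1} H"
    unfolding H_def using cont\<gamma> by (intro continuous_intros)

  define G where "G x = (H x + \<bar>r 0 - s\<bar>) / ?N" for x
  have G_mono: "strict_mono_on {0..1} G"
    using H_mono N by (simp add: monotone_on_def G_def divide_strict_right_mono)
  have "?\<sigma> * (r 0 - s) = \<bar>r 0 - s\<bar>" "?\<sigma>' * (t - r 1) = \<bar>t - r 1\<bar>"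
    by (simp_all add: abs_sgn mult.commute)
  then have "H 0 = - \<bar>r 0 - s\<bar>" "H 1 = 1 + \<bar>t - r 1\<bar>"
    using H0[of 0] H1[of 1] ab start finish by (simp_all add: algebra_simps)
  then have G01: "G 0 = 0" "G 1 = 1"
    using N by (simp_all add: G_def) (simp add: arc_length_def)
  have "continuous_on {0..1} G"
    unfolding G_def using H_cont N by (intro continuous_intros) auto
  then have "{0..1} \<subseteq> G ` {0..1}"
    using IVT'[of G 0 _ 1] G01 by (force simp: image_iff)
  moreover have "G ` {0..1} \<subseteq> {0..1}"
    using strict_mono_on_leD[OF G_mono, of 0] strict_mono_on_leD[OF G_mono, of _ 1] G01 by auto
  ultimately have G_im: "G ` {0..1} = {0..1}" by blast
  \<comment> \<open>Two factors \<open>sgn\<close> cancel unless the sign is 0; the side condition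
    covers that case, where the layer must be trivial.\<close>
  have sgn_sq: "sgn u * (sgn u * v) = v" if "u = 0 \<Longrightarrow> v = 0" for u v :: real
    using that by (auto simp: sgn_if)
  have "\<gamma> x = sing_arc s r t (G x)" if x: "x \<in> {0..1}" for x
  proof -
    have arc: "sing_arc s r t (G x) = arc_point s r t (H x)"
      using N by (simp add: sing_arc_def G_def)
    consider "x \<in> {0..a}" | "x \<in> {a..b}" | "x \<in> {b..1}" using x by force
    then show ?thesis
    proof cases
      case 1
      have "H x \<le> H a" using strict_mono_on_leD[OF m0, of x a] 1 by auto
      then have "H x \<le> 0" using Hmid[of a] xi_a ab by simp
      then have c: "clamp01 (H x) = 0" "min (H x) 0 = H x" "max (H x - 1) 0 = 0" by (auto simp: clamp01_def)
      \<comment> \<open>If \<open>s = r 0\<close>, then \<open>a > 0\<close> would give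
        \<open>H 0 = H a\<close> against strict monotonicity; hence \<open>a = 0\<close> and
        \<open>x\<close> is that single parameter.\<close>
      have "?\<rho> x = r 0" if "r 0 - s = 0"
      proof (cases "a = 0")
        case False
        then have "H 0 < H a" using strict_mono_onD[OF m0, of 0 a] ab by simp
        then show ?thesis using that \<open>H 0 = - \<bar>r 0 - s\<bar>\<close> Hmid[of a] xi_a ab by simp
      qed (use 1 \<gamma>a in auto)
      then have "?\<sigma> * H x = ?\<rho> x - r 0" unfolding H0[OF 1] by (intro sgn_sq) simp
      then show ?thesis unfolding arc arc_point_def c using lay0[OF 1] by simp
    next
      case 2
      have "H a \<le> H x" "H x \<le> H b" using strict_mono_on_leD[OF m] 2 by auto
      then have "0 \<le> H x" "H x \<le> 1" using Hmid[of a] Hmid[of b] xi_a xi_b ab by simp_all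
      then have c: "clamp01 (H x) = H x" "min (H x) 0 = 0" "max (H x - 1) 0 = 0" by (auto simp: clamp01_def)
      show ?thesis unfolding arc arc_point_def c using mid[OF 2] by (simp add: Hmid[OF 2])
    next
      case 3
      have "H b \<le> H x" using strict_mono_on_leD[OF m1, of b x] 3 by auto
      then have "1 \<le> H x" using Hmid[of b] xi_b ab by simp
      then have c: "clamp01 (H x) = 1" "min (H x) 0 = 0" "max (H x - 1) 0 = H x - 1" by (auto simp: clamp01_def)
      have "?\<rho> x = r 1" if "t - r 1 = 0"
      proof (cases "b = 1")
        case False
        then have "H b < H 1" using strict_mono_onD[OF m1, of b 1] ab by simp
        then show ?thesis using that \<open>H 1 = 1 + \<bar>t - r 1\<bar>\<close> Hmid[of b] xi_b ab by simp
      qed (use 3 \<gamma>b in auto)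
      then have "?\<sigma>' * (H x - 1) = ?\<rho> x - r 1" using sgn_sq[of "t - r 1" "?\<rho> x - r 1"] unfolding H1[OF 3] by auto
      then show ?thesis unfolding arc arc_point_def c using lay1[OF 3] by simp
    qed
  qed
  with G_mono G_im show ?thesis by (rule oriented_curve_reparam)
qed

section \<open>Reduced orbits\<close>

text \<open>These are the two branches of \<open>r * (1 - r) = c / (4 * k)\<close>; a sign
  \<open>s\<close> with \<open>s * s = 1\<close> treats both at once. The bound
  \<open>c < k x\<close> keeps the radicand positive, where the root is differentiable.\<close>

lemma sqrt_branch_reduced_equation:
  fixes k :: "real \<Rightarrow> real"
  assumes k: "(k has_real_derivative k') (at x within S)" and "k x > 0" and "c < k x" and "s * s = 1"
  defines "r \<equiv> \<lambda>x. (1 + s * sqrt (1 - c / k x)) / 2"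
  shows "\<exists>r'. (r has_real_derivative r') (at x within S) \<and>
    (1 - 2 * r x) * r' = - (k' / k x) * r x * (1 - r x)"
proof -
  let ?q = "1 - c / k x"
  have q: "?q > 0" using assms by (simp add: field_simps)
  have nz: "sqrt ?q \<noteq> 0" using real_sqrt_gt_zero[OF q] by linarith
  have "((\<lambda>x. 1 - c / k x) has_real_derivative c * k' / (k x * k x)) (at x within S)"
    using k \<open>k x > 0\<close> by (auto intro!: derivative_eq_intros simp del: mult_cancel_left mult_cancel_right)
  from DERIV_chain2[OF DERIV_real_sqrt[OF q] this]
  have "((\<lambda>x. sqrt (1 - c / k x)) has_real_derivative
      inverse (sqrt ?q) / 2 * (c * k' / (k x * k x))) (at x within S)" .
  then have "(r has_real_derivative (0 + s * (inverse (sqrt ?q) / 2 * (c * k' / (k x * k x)))) / 2) (at x within S)"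
    unfolding r_def by (intro DERIV_cdivide DERIV_add DERIV_const DERIV_cmult)
  then have deriv: "(r has_real_derivative s * (inverse (sqrt ?q) / 2 * (c * k' / (k x * k x))) / 2) (at x within S)"
    by (simp only: add_0)
  have "r x * (1 - r x) = (1 - (s * s) * (sqrt ?q * sqrt ?q)) / 4"
    unfolding r_def by (simp add: field_simps)
  also have "\<dots> = c / (4 * k x)"
    using q assms(4) by simp
  finally have rr: "r x * (1 - r x) = c / (4 * k x)" .
  \<comment> \<open>As \<open>1 - 2 * r x\<close> is \<open>- s * sqrt ?q\<close>, the root cancels
    against the inverse root from the derivative.\<close>
  have "(1 - 2 * r x) * (s * (inverse (sqrt ?q) / 2 * (c * k' / (k x * k x))) / 2)
    = - ((s * s) * (sqrt ?q * inverse (sqrt ?q)) * (c * k' / (k x * k x)) / 4)"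
    unfolding r_def by (simp add: field_simps)
  also have "\<dots> = - (k' / k x) * (r x * (1 - r x))"
    using nz assms(4) \<open>k x > 0\<close> unfolding rr by (simp add: mult_ac)
  finally show ?thesis using deriv by (auto simp: mult.assoc)
qed

lemma sqrt_branch_bounds:
  fixes u c s :: real
  assumes "0 \<le> c" "c \<le> u" "0 < u" "s = 1 \<or> s = -1"
  shows "(1 + s * sqrt (1 - c / u)) / 2 \<in> {0..1}"
proof -
  have "0 \<le> c / u" "c / u \<le> 1" using assms by (auto simp: field_simps)
  then have "0 \<le> sqrt (1 - c / u)" "sqrt (1 - c / u) \<le> 1" by auto
  then have "(1 + sqrt (1 - c / u)) / 2 \<in> {0..1}" "(1 - sqrt (1 - c / u)) / 2 \<in> {0..1}"
    by (auto simp: field_simps intro: order_trans[of "-1" 0])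
  then show ?thesis using assms(4) by (auto simp del: atLeastAtMost_iff)
qed

text \<open>As \<open>c\<close> stays below \<open>k\<close>, the branch never meets the fold line
  and lies on one side of \<open>1/2\<close> over all of \<open>{0..1}\<close>.\<close>

lemma reduced_orbit_sqrt_branch:
  assumes k: "\<And>x. x \<in> {0..1} \<Longrightarrow> (k has_real_derivative k' x) (at x within {0..1})"
    and "0 \<le> c" and c: "\<And>x. x \<in> {0..1} \<Longrightarrow> c < k x" and s: "s = 1 \<or> s = -1"
  shows "reduced_orbit k k' xs {0..1} (\<lambda>x. (1 + s * sqrt (1 - c / k x)) / 2)"
proof -
  have kpos: "k x > 0" if "x \<in> {0..1}" for x using c[OF that] \<open>0 \<le> c\<close> by linarith
  have pos: "sqrt (1 - c / k x) > 0" if "x \<in> {0..1}" for x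
    using c[OF that] kpos[OF that] by (simp add: field_simps)
  have "(\<lambda>x. (1 + s * sqrt (1 - c / k x)) / 2) ` {0..1} \<subseteq> {0..1}"
    using sqrt_branch_bounds[OF \<open>0 \<le> c\<close> _ _ s] c kpos by (auto simp: less_imp_le simp del: atLeastAtMost_iff)
  moreover have "\<forall>x\<in>{0..1}. \<exists>r'. ((\<lambda>x. (1 + s * sqrt (1 - c / k x)) / 2) has_real_derivative r') (at x within {0..1}) \<and>
        (1 - 2 * ((1 + s * sqrt (1 - c / k x)) / 2)) * r' =
        - (k' x / k x) * ((1 + s * sqrt (1 - c / k x)) / 2) * (1 - (1 + s * sqrt (1 - c / k x)) / 2)"
    by (intro ballI sqrt_branch_reduced_equation k kpos c) (use s in auto)
  moreover have "(\<forall>x\<in>{0..1}. (1 + s * sqrt (1 - c / k x)) / 2 > 1/2) \<or> (\<forall>x\<in>{0..1}. (1 + s * sqrt (1 - c / k x)) / 2 < 1/2)"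
    using pos s by auto
  ultimately show ?thesis unfolding reduced_orbit_def by blast
qed

section \<open>Differentiability of the canard at its fold point\<close>

lemma tendsto_second_difference_quotient:
  fixes k k' :: "real \<Rightarrow> real"
  assumes k: "\<forall>\<^sub>F x in nhds c. (k has_real_derivative k' x) (at x)"
    and k': "(k' has_real_derivative d) (at c)" and "k' c = 0"
  shows "((\<lambda>x. (k x - k c) / (x - c)\<^sup>2) \<longlongrightarrow> d / 2) (at c)"
proof (rule lhopital)
  have "isCont k c"
    using eventually_nhds_x_imp_x[OF k] by (rule DERIV_isCont)
  then show "((\<lambda>x. k x - k c) \<longlongrightarrow> 0) (at c)"
    by (simp add: isCont_def LIM_zero)
  show "((\<lambda>x. (x - c)\<^sup>2) \<longlongrightarrow> 0) (at c)"
    by (auto intro!: tendsto_eq_intros)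
  show "\<forall>\<^sub>F x in at c. (x - c)\<^sup>2 \<noteq> 0" "\<forall>\<^sub>F x in at c. 2 * (x - c) \<noteq> 0"
    by (auto simp: eventually_at_filter)
  show "\<forall>\<^sub>F x in at c. ((\<lambda>x. k x - k c) has_real_derivative k' x) (at x)"
    using k unfolding eventually_at_filter
    by (elim eventually_mono) (auto intro!: derivative_eq_intros)
  show "\<forall>\<^sub>F x in at c. ((\<lambda>x. (x - c)\<^sup>2) has_real_derivative 2 * (x - c)) (at x)"
    by (auto intro!: always_eventually derivative_eq_intros)
  \<comment> \<open>The quotient of the derivatives remains; because \<open>k' c = 0\<close>, it is
    half the difference quotient of \<open>k'\<close> at \<open>c\<close>.\<close>
  have "((\<lambda>x. (k' x - k' c) / (x - c)) \<longlongrightarrow> d) (at c)"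
    using k' by (simp add: has_field_derivative_iff)
  then have "((\<lambda>x. (k' x - k' c) / (x - c) / 2) \<longlongrightarrow> d / 2) (at c)"
    by (intro tendsto_intros) auto
  then show "((\<lambda>x. k' x / (2 * (x - c))) \<longlongrightarrow> d / 2) (at c)"
    using \<open>k' c = 0\<close> by (simp add: mult.commute)
qed

text \<open>\<open>k x - k xs\<close> vanishes to second order, so its root behaves like a multiple
  of \<open>\<bar>x - xs\<bar>\<close>; the change of branch at \<open>xs\<close> supplies the sign
  that removes the corner.\<close>

lemma canard_has_derivative_at_canard_pt:
  fixes k k' :: "real \<Rightarrow> real"
  assumes k: "\<forall>\<^sub>F x in nhds xs. (k has_real_derivative k' x) (at x)"
    and k': "(k' has_real_derivative d) (at xs)" and "k' xs = 0" and "k xs > 0"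
  shows "(canard k xs has_real_derivative - sqrt (d / 2 / k xs) / 2) (at xs)"
proof -
  have cont: "isCont k xs"
    using eventually_nhds_x_imp_x[OF k] by (rule DERIV_isCont)
  have "((\<lambda>x. (k x - k xs) / (x - xs)\<^sup>2 / k x) \<longlongrightarrow> d / 2 / k xs) (at xs)"
    by (rule tendsto_divide[OF tendsto_second_difference_quotient[OF k k' \<open>k' xs = 0\<close>]])
      (use cont \<open>k xs > 0\<close> in \<open>auto simp: isCont_def\<close>)
  then have lim: "((\<lambda>x. - sqrt ((k x - k xs) / (x - xs)\<^sup>2 / k x) / 2) \<longlongrightarrow> - sqrt (d / 2 / k xs) / 2) (at xs)"
    by (rule tendsto_divide[OF tendsto_minus[OF tendsto_real_sqrt] tendsto_const]) simp
  have "\<forall>\<^sub>F x in nhds xs. k x > 0"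
    using cont \<open>k xs > 0\<close> by (simp add: isCont_def tendsto_at_iff_tendsto_nhds order_tendstoD(1))
  then have "\<forall>\<^sub>F x in at xs. - sqrt ((k x - k xs) / (x - xs)\<^sup>2 / k x) / 2 =
      (canard k xs x - canard k xs xs) / (x - xs)"
    unfolding eventually_at_filter
  proof (elim eventually_mono, intro impI)
    fix x assume "k x > 0" "x \<noteq> xs"
    have "sqrt ((k x - k xs) / (x - xs)\<^sup>2 / k x) = sqrt ((1 - k xs / k x) / (x - xs)\<^sup>2)"
      using \<open>k x > 0\<close> by (simp add: field_simps)
    also have "\<dots> = sqrt (1 - k xs / k x) / \<bar>x - xs\<bar>"
      by (simp add: real_sqrt_divide)
    finally have *: "sqrt ((k x - k xs) / (x - xs)\<^sup>2 / k x) = sqrt (1 - k xs / k x) / \<bar>x - xs\<bar>" .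
    show "- sqrt ((k x - k xs) / (x - xs)\<^sup>2 / k x) / 2 = (canard k xs x - canard k xs xs) / (x - xs)"
      unfolding * using \<open>x \<noteq> xs\<close> \<open>k xs > 0\<close> by (auto simp: canard_def field_simps abs_if)
  qed
  from Lim_transform_eventually[OF lim this] show ?thesis
    by (simp add: has_field_derivative_iff)
qed

text \<open>Away from \<open>xs\<close> the canard is locally a square root branch with
  \<open>c = k xs\<close>. At \<open>xs\<close> it is differentiable, and both sides of the reduced
  equation vanish because \<rho> is \<open>1/2\<close> and \<open>k' xs = 0\<close>.\<close>

lemma reduced_orbit_canard:
  assumes k: "\<And>x. x \<in> {0..1} \<Longrightarrow> (k has_real_derivative k' x) (at x within {0..1})"
    and k': "\<And>x. x \<in> {0..1} \<Longrightarrow> (k' has_real_derivative k'' x) (at x within {0..1})"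
    and kpos: "\<And>x. x \<in> {0..1} \<Longrightarrow> k x > 0"
    and xs: "xs \<in> {0<..<1}"
    and min: "\<And>x. x \<in> {0..1} \<Longrightarrow> x \<noteq> xs \<Longrightarrow> k xs < k x"
    and crit: "k' xs = 0"
  shows "reduced_orbit k k' xs {0..1} (canard k xs)"
proof -
  have at: "at x within {0..1} = at x" if "x \<in> {0<..<1}" for x :: real
    using that by (intro at_within_interior) auto
  have "canard k xs ` {0..1} \<subseteq> {0..1}"
  proof (intro subsetI, elim imageE)
    fix y x :: real assume y: "y = canard k xs x" and x: "x \<in> {0..1}"
    have "0 \<le> k xs" "k xs \<le> k x" "0 < k x"
      using kpos[of xs] kpos[OF x] min[OF x] xs by (auto simp: less_imp_le) force
    from sqrt_branch_bounds[OF this] show "y \<in> {0..1}"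
      unfolding y canard_def by (metis (no_types, opaque_lifting) diff_conv_add_uminus mult_1 mult_minus1)
  qed
  moreover have "\<exists>r'. (canard k xs has_real_derivative r') (at x within {0..1}) \<and>
      (1 - 2 * canard k xs x) * r' = - (k' x / k x) * canard k xs x * (1 - canard k xs x)"
    if x: "x \<in> {0..1}" for x
  proof (cases "x = xs")
    case True
    have "\<forall>\<^sub>F x in nhds xs. x \<in> {0<..<1}"
      using xs by (intro eventually_nhds_in_open) auto
    then have "\<forall>\<^sub>F x in nhds xs. (k has_real_derivative k' x) (at x)"
    proof (rule eventually_mono)
      fix x :: real assume x: "x \<in> {0<..<1}"
      then show "(k has_real_derivative k' x) (at x)" using k[of x] at[OF x] by simp
    qed
    moreover have "(k' has_real_derivative k'' xs) (at xs)"
      using k'[of xs] at[OF xs] xs by auto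
    ultimately have "(canard k xs has_real_derivative - sqrt (k'' xs / 2 / k xs) / 2) (at xs)"
      by (rule canard_has_derivative_at_canard_pt) (use crit kpos[of xs] xs in auto)
    moreover have "canard k xs xs = 1/2" using kpos[of xs] xs by (simp add: canard_def)
    ultimately show ?thesis using True crit at[OF xs] by auto
  next
    case False
    define s :: real where "s = (if x \<le> xs then 1 else -1)"
    have ss: "s * s = 1" by (simp add: s_def)
    let ?r = "\<lambda>x. (1 + s * sqrt (1 - k xs / k x)) / 2"
    obtain r' where r': "(?r has_real_derivative r') (at x within {0..1})"
      "(1 - 2 * ?r x) * r' = - (k' x / k x) * ?r x * (1 - ?r x)"
      using sqrt_branch_reduced_equation[OF k[OF x] kpos[OF x] min[OF x False] ss] by blast
    \<comment> \<open>Points closer to \<open>x\<close> than \<open>xs\<close> is lie on the same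
      side of \<open>xs\<close>, hence on the same branch.\<close>
    have eq: "?r y = canard k xs y" if "dist y x < \<bar>x - xs\<bar>" for y
    proof -
      have "y \<le> xs \<longleftrightarrow> x \<le> xs" using that by (simp add: dist_real_def) linarith
      then show ?thesis by (simp add: s_def canard_def)
    qed
    have "(canard k xs has_real_derivative r') (at x within {0..1})"
      by (rule has_field_derivative_transform_within[OF r'(1), of "\<bar>x - xs\<bar>"]) (use False x eq in auto)
    then show ?thesis using r'(2) eq[of x] False by auto
  qed
  ultimately show ?thesis unfolding reduced_orbit_def by blast
qed

text \<open>The derivative is \<open>k' r (1 - r) + k (1 - 2 r) r'\<close>, which the reduced
  equation makes zero. Nothing is divided by \<open>1 - 2 r\<close>, so conservation persists
  through the canard point.\<close>

lemma reduced_orbit_conserved: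
  assumes k: "\<And>x. x \<in> {0..1} \<Longrightarrow> (k has_real_derivative k' x) (at x within {0..1})"
    and kpos: "\<And>x. x \<in> {0..1} \<Longrightarrow> k x > 0"
    and orb: "reduced_orbit k k' xs {0..1} r" and "x \<in> {0..1}" "y \<in> {0..1}"
  shows "k x * (r x * (1 - r x)) = k y * (r y * (1 - r y))"
proof -
  have "\<exists>c. \<forall>x\<in>{0..1}. k x * (r x * (1 - r x)) = c"
  proof (rule has_field_derivative_zero_constant)
    fix x :: real assume x: "x \<in> {0..1}"
    then obtain r' where r': "(r has_real_derivative r') (at x within {0..1})"
        "(1 - 2 * r x) * r' = - (k' x / k x) * r x * (1 - r x)"
      using orb unfolding reduced_orbit_def by blast
    have "((\<lambda>x. k x * (r x * (1 - r x))) has_real_derivative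
        k' x * (r x * (1 - r x)) + k x * ((1 - 2 * r x) * r')) (at x within {0..1})"
      using k[OF x] r'(1) by (auto intro!: derivative_eq_intros simp: algebra_simps)
    moreover have "k' x * (r x * (1 - r x)) + k x * ((1 - 2 * r x) * r') = 0"
      unfolding r'(2) using kpos[OF x] by (simp add: field_simps)
    ultimately show "((\<lambda>x. k x * (r x * (1 - r x))) has_real_derivative 0) (at x within {0..1})"
      by simp
  qed simp
  then show ?thesis using assms(4,5) by auto
qed

text \<open>\<open>a\<close> and \<open>1 - a\<close> are the only heights with the given flux, and
  they lie on opposite sides of \<open>1/2\<close>.\<close>

lemma branch_unique:
  fixes a b :: real
  assumes "a * (1 - a) = b * (1 - b)" and "a < 1/2 \<and> b < 1/2 \<or> a > 1/2 \<and> b > 1/2"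
  shows "a = b"
proof -
  have "(a - b) * (1 - a - b) = 0" using assms(1) by (simp add: algebra_simps)
  then show ?thesis using assms(2) by auto
qed

section \<open>Boundary conditions\<close>

lemma reduced_orbit_continuous:
  assumes "reduced_orbit k k' xs I r"
  shows "continuous_on I r"
  using assms unfolding reduced_orbit_def
  by (meson DERIV_continuous continuous_on_eq_continuous_within)

lemma left_pts_eq:
  assumes "p \<in> left_pts \<alpha>" "j_of p = J" "\<alpha> > 0"
  shows "p = (J, 0, 1 - J / \<alpha>)"
  using assms unfolding left_pts_def by (auto simp: field_simps)

lemma right_pts_eq:
  assumes "p \<in> right_pts \<beta>" "j_of p = J" "\<beta> > 0"
  shows "p = (J, 1, J / \<beta>)"
  using assms unfolding right_pts_def by (auto simp: field_simps)

text \<open>Apart from nonnegativity, membership in \<open>left_pts\<close> is an upper bound on the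
  flux: \<open>\<alpha> * (1 - \<alpha>)\<close> for \<open>\<alpha> \<le> 1/2\<close>, and
  \<open>1/4\<close> above. The alternative \<open>a = \<alpha>\<close> is a start without
  layer.\<close>

lemma left_ptsI:
  fixes a \<alpha> :: real
  assumes "0 < a" "a < 1" "0 < \<alpha>" and a: "a = \<alpha> \<or> 1/2 < a \<and> 1 - a \<le> \<alpha>"
  shows "(a * (1 - a), 0, 1 - a * (1 - a) / \<alpha>) \<in> left_pts \<alpha>"
proof -
  have "a * (1 - a) \<ge> 0" using assms by simp
  moreover have "rho_left \<alpha> \<le> 1 - a * (1 - a) / \<alpha>"
  proof (cases "\<alpha> \<le> 1/2")
    case True
    \<comment> \<open>This product is \<open>\<alpha> * (1 - \<alpha>) - a * (1 - a)\<close>,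
      factored so that its sign can be read off.\<close>
    have "(\<alpha> - (1 - a)) * (a - \<alpha>) \<ge> 0" using a True by auto
    then have "a * (1 - a) \<le> \<alpha> * (1 - \<alpha>)" by (simp add: algebra_simps)
    then show ?thesis using True \<open>0 < \<alpha>\<close> by (simp add: rho_left_def field_simps)
  next
    case False
    have "(2 * a - 1) * (2 * a - 1) \<ge> 0" by simp
    then have "a * (1 - a) \<le> 1/4" by (simp add: algebra_simps)
    then have "a * (1 - a) / \<alpha> \<le> 1/4 / \<alpha>" using \<open>0 < \<alpha>\<close> by (intro divide_right_mono) auto
    then show ?thesis using False by (simp add: rho_left_def)
  qed
  ultimately show ?thesis unfolding left_pts_def using \<open>0 < \<alpha>\<close>
    by (auto intro!: exI[of _ "1 - a * (1 - a) / \<alpha>"])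
qed

text \<open>The reflection of \<rho> to \<open>1 - \<rho>\<close>, with \<alpha> and \<beta>
  exchanged, turns this into the situation at the left end.\<close>

lemma right_ptsI:
  fixes b \<beta> :: real
  assumes "0 < b" "b < 1" "0 < \<beta>" and b: "b = 1 - \<beta> \<or> b < 1/2 \<and> b \<le> \<beta>"
  shows "(b * (1 - b), 1, b * (1 - b) / \<beta>) \<in> right_pts \<beta>"
proof -
  have "b * (1 - b) \<ge> 0" using assms by simp
  moreover have "b * (1 - b) / \<beta> \<le> rho_right \<beta>"
  proof (cases "\<beta> \<le> 1/2")
    case True
    have "(\<beta> - b) * (1 - b - \<beta>) \<ge> 0" using b True by auto
    then have "b * (1 - b) \<le> \<beta> * (1 - \<beta>)" by (simp add: algebra_simps)
    then show ?thesis using True \<open>0 < \<beta>\<close> by (simp add: rho_right_def field_simps)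
  next
    case False
    have "(2 * b - 1) * (2 * b - 1) \<ge> 0" by simp
    then have "b * (1 - b) \<le> 1/4" by (simp add: algebra_simps)
    then have "b * (1 - b) / \<beta> \<le> 1/4 / \<beta>" using \<open>0 < \<beta>\<close> by (intro divide_right_mono) auto
    then show ?thesis using False by (simp add: rho_right_def)
  qed
  ultimately show ?thesis unfolding right_pts_def using \<open>0 < \<beta>\<close>
    by (auto intro!: exI[of _ "b * (1 - b) / \<beta>"])
qed

text \<open>The heights solve \<open>\<alpha> * (1 - s) = r 0 * (1 - r 0)\<close> and
  \<open>\<beta> * t = r 1 * (1 - r 1)\<close>: each boundary line is met at the constant flux of
  its layer.\<close>

definition bvp_arc :: "(real \<Rightarrow> real) \<Rightarrow> real \<Rightarrow> real \<Rightarrow> real \<Rightarrow> point" where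
  "bvp_arc r \<alpha> \<beta> = sing_arc (1 - r 0 * (1 - r 0) / \<alpha>) r (r 1 * (1 - r 1) / \<beta>)"

text \<open>Turns the position of the entry height relative to the equilibria \<open>a\<close> and
  \<open>1 - a\<close> into inequalities for \<alpha>, as they occur in the regions. Each difference
  of heights is a positive factor times \<open>\<alpha> - a\<close> or
  \<open>\<alpha> - (1 - a)\<close>.\<close>

lemma entry_height:
  fixes a \<alpha> :: real
  assumes "0 < a" "a < 1" "0 < \<alpha>"
  shows "1 - a * (1 - a) / \<alpha> = a \<longleftrightarrow> \<alpha> = a" "1 - a * (1 - a) / \<alpha> < a \<longleftrightarrow> \<alpha> < a"
    "1 - a * (1 - a) / \<alpha> > a \<longleftrightarrow> \<alpha> > a" "1 - a \<le> 1 - a * (1 - a) / \<alpha> \<longleftrightarrow> 1 - a \<le> \<alpha>"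
proof -
  have "1 - a * (1 - a) / \<alpha> - a = (1 - a) / \<alpha> * (\<alpha> - a)"
    using assms by (simp add: field_simps)
  moreover have "(1 - a) / \<alpha> > 0" using assms by simp
  ultimately show "1 - a * (1 - a) / \<alpha> = a \<longleftrightarrow> \<alpha> = a" "1 - a * (1 - a) / \<alpha> < a \<longleftrightarrow> \<alpha> < a"
    "1 - a * (1 - a) / \<alpha> > a \<longleftrightarrow> \<alpha> > a"
    by (smt (verit) mult_eq_0_iff mult_pos_pos mult_pos_neg)+
  have "1 - a * (1 - a) / \<alpha> - (1 - a) = a / \<alpha> * (\<alpha> - (1 - a))"
    using assms by (simp add: field_simps)
  moreover have "a / \<alpha> > 0" using assms by simp
  ultimately show "1 - a \<le> 1 - a * (1 - a) / \<alpha> \<longleftrightarrow> 1 - a \<le> \<alpha>"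
    by (smt (verit) mult_eq_0_iff mult_pos_pos mult_pos_neg)
qed

text \<open>The exit height at \<open>b\<close> is 1 minus the entry height at \<open>1 - b\<close>,
  so the inequalities reverse.\<close>

lemma exit_height:
  fixes b \<beta> :: real
  assumes "0 < b" "b < 1" "0 < \<beta>"
  shows "b * (1 - b) / \<beta> = b \<longleftrightarrow> \<beta> = 1 - b" "b * (1 - b) / \<beta> > b \<longleftrightarrow> \<beta> < 1 - b"
    "b * (1 - b) / \<beta> < b \<longleftrightarrow> \<beta> > 1 - b" "b * (1 - b) / \<beta> \<le> 1 - b \<longleftrightarrow> b \<le> \<beta>"
  using entry_height[of "1 - b" \<beta>] assms by (auto simp: mult.commute)

lemma singular_path_bvp_arc:
  assumes orb: "reduced_orbit k k' xs {0..1} r"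
    and "0 < r 0" "r 0 < 1" "0 < r 1" "r 1 < 1" "0 < \<alpha>" "0 < \<beta>"
    and a: "r 0 = \<alpha> \<or> 1/2 < r 0 \<and> 1 - r 0 \<le> \<alpha>" and b: "r 1 = 1 - \<beta> \<or> r 1 < 1/2 \<and> r 1 \<le> \<beta>"
  shows "singular_path k k' xs \<alpha> \<beta> (bvp_arc r \<alpha> \<beta>)"
proof -
  let ?s = "1 - r 0 * (1 - r 0) / \<alpha>" and ?t = "r 1 * (1 - r 1) / \<beta>"
  note entry = entry_height[of "r 0" \<alpha>, OF assms(2,3,6)]
  note exit = exit_height[of "r 1" \<beta>, OF assms(4,5,7)]
  show ?thesis
    unfolding bvp_arc_def
  proof (rule singular_pathI[where a = "arc_in ?s r ?t" and b = "arc_out ?s r ?t"])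
    show "path (sing_arc ?s r ?t)" using orb by (intro path_arc reduced_orbit_continuous)
    show "pathstart (sing_arc ?s r ?t) \<in> left_pts \<alpha>"
      unfolding pathstart_def arc_start using assms by (intro left_ptsI) auto
    show "pathfinish (sing_arc ?s r ?t) \<in> right_pts \<beta>"
      unfolding pathfinish_def arc_finish using assms by (intro right_ptsI) auto
    show "reduced_segment k k' xs (sing_arc ?s r ?t) (arc_in ?s r ?t) (arc_out ?s r ?t)"
      using orb by (rule arc_reduced_segment)
    show "arc_in ?s r ?t = 0 \<or> layer_segment (sing_arc ?s r ?t) 0 (arc_in ?s r ?t)"
    proof (cases "?s = r 0")
      case False
      then have "1/2 < r 0" "1 - r 0 \<le> ?s" using a entry(1,4) by blast+
      then show ?thesis using False by (intro disjI2 arc_layer_at_0(1))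
    qed (use arc_breaks(4) in blast)
    show "arc_out ?s r ?t = 1 \<or> layer_segment (sing_arc ?s r ?t) (arc_out ?s r ?t) 1"
    proof (cases "?t = r 1")
      case False
      then have "r 1 \<noteq> 1 - \<beta>" using exit(1) by linarith
      then have "r 1 < 1/2" "?t \<le> 1 - r 1" using b exit(4) by blast+
      then show ?thesis using False by (intro disjI2 arc_layer_at_1(1))
    qed (use arc_breaks(5) in blast)
  qed
qed

text \<open>Reduces each type to naming its orbit \<open>r\<close>. A curve following
  \<open>r\<close> has the end fluxes of \<open>r\<close> in its layers; the boundary lines then
  force on it the end points of \<open>bvp_arc\<close>, so it is a reparametrisation of that
  curve.\<close>

lemma unique_oriented_curve:
  assumes pos: "0 < \<alpha>" "0 < \<beta>"
    and ex: "singular_path k k' xs \<alpha> \<beta> (bvp_arc r \<alpha> \<beta>)" "has_type k k' xs i (bvp_arc r \<alpha> \<beta>)"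
    and fol: "\<And>\<gamma>. singular_path k k' xs \<alpha> \<beta> \<gamma> \<Longrightarrow> has_type k k' xs i \<gamma> \<Longrightarrow> \<exists>a b. follows_orbit r \<gamma> a b"
  shows "\<exists>!\<Gamma>. \<Gamma> \<in> singular_solutions k k' xs \<alpha> \<beta> i \<and>
           (\<forall>\<gamma>\<in>\<Gamma>. xi_of (\<gamma> 0) = 0 \<and> j_of (\<gamma> 0) = \<alpha> * (1 - rho_of (\<gamma> 0)) \<and>
                  xi_of (\<gamma> 1) = 1 \<and> j_of (\<gamma> 1) = \<beta> * rho_of (\<gamma> 1))"
proof (rule ex1I[of _ "oriented_curve (bvp_arc r \<alpha> \<beta>)"])
  show "oriented_curve (bvp_arc r \<alpha> \<beta>) \<in> singular_solutions k k' xs \<alpha> \<beta> i \<and>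
           (\<forall>\<gamma>\<in>oriented_curve (bvp_arc r \<alpha> \<beta>). xi_of (\<gamma> 0) = 0 \<and> j_of (\<gamma> 0) = \<alpha> * (1 - rho_of (\<gamma> 0)) \<and>
                  xi_of (\<gamma> 1) = 1 \<and> j_of (\<gamma> 1) = \<beta> * rho_of (\<gamma> 1))"
    using ex pos unfolding singular_solutions_def
    by (auto simp: oriented_curve_ends bvp_arc_def arc_start arc_finish)
next
  fix \<Gamma> assume "\<Gamma> \<in> singular_solutions k k' xs \<alpha> \<beta> i \<and>
           (\<forall>\<gamma>\<in>\<Gamma>. xi_of (\<gamma> 0) = 0 \<and> j_of (\<gamma> 0) = \<alpha> * (1 - rho_of (\<gamma> 0)) \<and>
                  xi_of (\<gamma> 1) = 1 \<and> j_of (\<gamma> 1) = \<beta> * rho_of (\<gamma> 1))"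
  then obtain \<gamma> where \<Gamma>: "\<Gamma> = oriented_curve \<gamma>"
    and sp: "singular_path k k' xs \<alpha> \<beta> \<gamma>" and "has_type k k' xs i \<gamma>"
    unfolding singular_solutions_def by blast
  then obtain a b where f: "follows_orbit r \<gamma> a b" using fol by blast
  then have ab: "0 \<le> a" "a < b" "b \<le> 1" unfolding follows_orbit_def by auto
  have "\<gamma> a = (r 0 * (1 - r 0), 0, r 0)" "\<gamma> b = (r 1 * (1 - r 1), 1, r 1)"
  proof -
    have *: "\<gamma> x = (r (xi_of (\<gamma> x)) * (1 - r (xi_of (\<gamma> x))), xi_of (\<gamma> x), r (xi_of (\<gamma> x)))"
      if "x \<in> {a..b}" for x
      using f that unfolding follows_orbit_def by blast
    have xi: "xi_of (\<gamma> a) = 0" "xi_of (\<gamma> b) = 1" using f unfolding follows_orbit_def by blast+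
    show "\<gamma> a = (r 0 * (1 - r 0), 0, r 0)" using *[of a] ab unfolding xi by simp
    show "\<gamma> b = (r 1 * (1 - r 1), 1, r 1)" using *[of b] ab unfolding xi by simp
  qed
  moreover have "a = 0 \<or> layer_segment \<gamma> 0 a" "b = 1 \<or> layer_segment \<gamma> b 1"
    using f unfolding follows_orbit_def layer_at_0_def layer_at_1_def by blast+
  ultimately have "j_of (\<gamma> 0) = r 0 * (1 - r 0)" "j_of (\<gamma> 1) = r 1 * (1 - r 1)"
    using layer_segment_const(1)[of \<gamma> 0 a 0 a] layer_segment_const(1)[of \<gamma> b 1 1 b] ab by auto
  then have "\<gamma> 0 = (r 0 * (1 - r 0), 0, 1 - r 0 * (1 - r 0) / \<alpha>)"
    "\<gamma> 1 = (r 1 * (1 - r 1), 1, r 1 * (1 - r 1) / \<beta>)"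
    using sp pos unfolding singular_path_def pathstart_def pathfinish_def
    by (auto intro: left_pts_eq right_pts_eq)
  then show "\<Gamma> = oriented_curve (bvp_arc r \<alpha> \<beta>)"
    unfolding \<Gamma> bvp_arc_def using sp f
    by (intro oriented_curve_eq_sing_arc) (auto simp: singular_path_def)
qed

lemma follows_orbitI:
  assumes seg: "reduced_segment k k' xs \<gamma> a b" and "xi_of (\<gamma> a) = 0" "xi_of (\<gamma> b) = 1"
    and rho: "\<And>x. x \<in> {a..b} \<Longrightarrow> rho_of (\<gamma> x) = r (xi_of (\<gamma> x))"
    and in0: "a = 0 \<or> layer_at_0 (<) \<gamma> a \<or> layer_at_0 (>) \<gamma> a"
    and out1: "b = 1 \<or> layer_at_1 (<) \<gamma> b \<or> layer_at_1 (>) \<gamma> b"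
  shows "follows_orbit r \<gamma> a b"
proof -
  have "0 \<le> a" "b \<le> 1"
    using in0 out1 unfolding layer_at_0_def layer_at_1_def layer_segment_def by auto
  moreover have "\<gamma> x = (r (xi_of (\<gamma> x)) * (1 - r (xi_of (\<gamma> x))), xi_of (\<gamma> x), r (xi_of (\<gamma> x)))"
    if "x \<in> {a..b}" for x
  proof -
    have "\<gamma> x \<in> crit_mfd" using seg that unfolding reduced_segment_def by blast
    then show ?thesis using rho[OF that] by (auto simp: crit_mfd_def prod_eq_iff)
  qed
  ultimately show ?thesis using assms unfolding follows_orbit_def reduced_segment_def by blast
qed

text \<open>With \<open>q = 1 - k xs / k 0\<close>, or its analogue at 1, this puts the conserved
  quantity of the orbit through \<open>a\<close> below that of the canard, so that the orbit exists
  over the whole of \<open>{0..1}\<close>.\<close>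

lemma below_sqrt_branch:
  fixes a q :: real
  assumes "a < (1 - sqrt q) / 2" "0 \<le> q"
  shows "4 * a * (1 - a) < 1 - q"
proof -
  have "sqrt q < 1 - 2 * a" using assms by simp
  then have "(sqrt q)\<^sup>2 < (1 - 2 * a)\<^sup>2" using assms by (intro power_strict_mono) auto
  then show ?thesis using assms by (simp add: power2_eq_square algebra_simps)
qed

lemma sqrt_branch_height:
  fixes a :: real
  assumes "a \<le> 1/2"
  shows "sqrt (1 - 4 * a * (1 - a)) = 1 - 2 * a"
proof -
  have "1 - 4 * a * (1 - a) = (1 - 2 * a)\<^sup>2" by (simp add: power2_eq_square algebra_simps)
  then show ?thesis using assms by simp
qed

section \<open>The eight types\<close>

locale bottleneck =
  fixes k k' k'' :: "real \<Rightarrow> real" and xs :: real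
  assumes k: "\<And>x. x \<in> {0..1} \<Longrightarrow> (k has_real_derivative k' x) (at x within {0..1})"
    and k': "\<And>x. x \<in> {0..1} \<Longrightarrow> (k' has_real_derivative k'' x) (at x within {0..1})"
    and kpos: "\<And>x. x \<in> {0..1} \<Longrightarrow> k x > 0"
    and xs: "xs \<in> {0<..<1}"
    and min: "\<And>x. x \<in> {0..1} \<Longrightarrow> x \<noteq> xs \<Longrightarrow> k xs < k x"
    and crit: "k' xs = 0"
begin

lemma k_ends: "0 < k xs" "k xs < k 0" "k xs < k 1" "0 < k 0" "0 < k 1"
  using kpos[of xs] min[of 0] min[of 1] kpos[of 0] kpos[of 1] xs by auto

lemma k_ge: "x \<in> {0..1} \<Longrightarrow> k xs \<le> k x"
  using min[of x] by (cases "x = xs") auto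

lemma rho_c_bounds: "0 < rho_c0 k xs" "rho_c0 k xs < 1/2" "1/2 < rho_c1 k xs" "rho_c1 k xs < 1"
proof -
  define S0 S1 where "S0 = sqrt (1 - k xs / k 0)" and "S1 = sqrt (1 - k xs / k 1)"
  have "0 < S0" "S0 < 1" "0 < S1" "S1 < 1"
    unfolding S0_def S1_def using k_ends by auto
  then show "0 < rho_c0 k xs" "rho_c0 k xs < 1/2" "1/2 < rho_c1 k xs" "rho_c1 k xs < 1"
    unfolding rho_c0_def rho_c1_def S0_def[symmetric] S1_def[symmetric] by auto
qed

text \<open>Agreement at the single point \<open>y\<close> equates the conserved quantities of the
  two orbits, and on a common branch that quantity determines the height.\<close>

lemma reduced_segment_rho_eq:
  assumes seg: "reduced_segment k k' xs \<gamma> a b" and xi: "xi_of (\<gamma> a) = 0" "xi_of (\<gamma> b) = 1"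
    and orb: "reduced_orbit k k' xs {0..1} r"
    and y: "y \<in> {a..b}" "rho_of (\<gamma> y) = r (xi_of (\<gamma> y))"
    and branch: "\<And>x. x \<in> {a..b} \<Longrightarrow> rho_of (\<gamma> x) < 1/2 \<and> r (xi_of (\<gamma> x)) < 1/2 \<or>
      rho_of (\<gamma> x) > 1/2 \<and> r (xi_of (\<gamma> x)) > 1/2"
    and x: "x \<in> {a..b}"
  shows "rho_of (\<gamma> x) = r (xi_of (\<gamma> x))"
proof -
  obtain r' where r': "reduced_orbit k k' xs {0..1} r'" "\<forall>t\<in>{a..b}. rho_of (\<gamma> t) = r' (xi_of (\<gamma> t))"
    using seg xi unfolding reduced_segment_def by auto
  have mono: "strict_mono_on {a..b} (\<lambda>t. xi_of (\<gamma> t))" using seg unfolding reduced_segment_def by blast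
  have xi_in: "xi_of (\<gamma> t) \<in> {0..1}" if "t \<in> {a..b}" for t
    using strict_mono_on_leD[OF mono, of a t] strict_mono_on_leD[OF mono, of t b] that xi by auto
  have cons: "k (xi_of (\<gamma> x)) * (f (xi_of (\<gamma> x)) * (1 - f (xi_of (\<gamma> x)))) =
      k (xi_of (\<gamma> y)) * (f (xi_of (\<gamma> y)) * (1 - f (xi_of (\<gamma> y))))"
    if "reduced_orbit k k' xs {0..1} f" for f
    by (rule reduced_orbit_conserved[OF k kpos that xi_in[OF x] xi_in[OF y(1)]])
  have "k (xi_of (\<gamma> x)) * (r (xi_of (\<gamma> x)) * (1 - r (xi_of (\<gamma> x)))) =
      k (xi_of (\<gamma> x)) * (rho_of (\<gamma> x) * (1 - rho_of (\<gamma> x)))"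
    using cons[OF orb] cons[OF r'(1)] r'(2) x y by simp
  then have "rho_of (\<gamma> x) * (1 - rho_of (\<gamma> x)) = r (xi_of (\<gamma> x)) * (1 - r (xi_of (\<gamma> x)))"
    using kpos[OF xi_in[OF x]] by simp
  then show ?thesis using branch[OF x] by (rule branch_unique)
qed

text \<open>On the repelling side the boundary condition at \<xi> = 0 meets the critical manifold
  only at height \<alpha>, which fixes the orbit. It arrives at height
  \<open>rho_upper_star k \<alpha>\<close>, and \<beta> decides on which side of it the exit height
  lies.\<close>

lemma unique_rep_then_layer:
  assumes \<alpha>: "0 < \<alpha>" "\<alpha> < rho_c0 k xs"
    and \<beta>: "i = 1 \<and> rho_upper_star k \<alpha> < \<beta> \<and> \<beta> < 1 - rho_upper_star k \<alpha> \<or>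
      i = 2 \<and> 1 - rho_upper_star k \<alpha> < \<beta> \<and> \<beta> < 1"
  shows "\<exists>!\<Gamma>. \<Gamma> \<in> singular_solutions k k' xs \<alpha> \<beta> i \<and>
           (\<forall>\<gamma>\<in>\<Gamma>. xi_of (\<gamma> 0) = 0 \<and> j_of (\<gamma> 0) = \<alpha> * (1 - rho_of (\<gamma> 0)) \<and>
                  xi_of (\<gamma> 1) = 1 \<and> j_of (\<gamma> 1) = \<beta> * rho_of (\<gamma> 1))"
proof -
  \<comment> \<open>Four times the conserved quantity of the orbit starting at height \<alpha>;
    \<open>\<alpha> < rho_c0 k xs\<close> puts it below the minimum of \<open>k\<close>.\<close>
  define c where "c = 4 * \<alpha> * (1 - \<alpha>) * k 0"
  define r where "r x = (1 + (-1) * sqrt (1 - c / k x)) / 2" for x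
  have \<alpha>_half: "\<alpha> < 1/2" using \<alpha>(2) rho_c_bounds by linarith
  have "4 * \<alpha> * (1 - \<alpha>) < 1 - (1 - k xs / k 0)"
    using \<alpha>(2) k_ends unfolding rho_c0_def by (intro below_sqrt_branch) auto
  then have "c < k xs" using k_ends by (simp add: c_def field_simps)
  then have c: "0 < c" "\<And>x. x \<in> {0..1} \<Longrightarrow> c < k x"
    using \<alpha> \<alpha>_half k_ends k_ge by (auto simp: c_def less_le_trans)
  have orb: "reduced_orbit k k' xs {0..1} r"
    unfolding r_def by (rule reduced_orbit_sqrt_branch[OF k]) (use c in auto)
  have r_bounds: "0 < r x \<and> r x < 1/2" if "x \<in> {0..1}" for x
  proof -
    have "0 < c / k x" "c / k x < 1" using c that kpos[OF that] by auto
    then show ?thesis by (simp add: r_def)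
  qed
  have r0: "r 0 = \<alpha>"
    using sqrt_branch_height[of \<alpha>] \<alpha>_half k_ends by (simp add: r_def c_def)
  have r1: "r 1 = rho_upper_star k \<alpha>" by (simp add: r_def c_def rho_upper_star_def)
  have b1: "0 < r 1" "r 1 < 1/2" using r_bounds[of 1] by auto
  then have \<beta>': "0 < \<beta>" "r 1 \<le> \<beta>" using \<beta> unfolding r1[symmetric] by auto
  let ?s = "1 - r 0 * (1 - r 0) / \<alpha>" and ?t = "r 1 * (1 - r 1) / \<beta>"
  have s: "?s = r 0" using \<alpha> r0 by simp
  note exit = exit_height[of "r 1" \<beta>]
  show ?thesis
  proof (rule unique_oriented_curve[of \<alpha> \<beta> _ _ _ r])
    show "singular_path k k' xs \<alpha> \<beta> (bvp_arc r \<alpha> \<beta>)"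
      using orb r_bounds[of 0] b1 \<alpha> \<beta>' r0 by (intro singular_path_bvp_arc) auto
    have in0: "arc_in ?s r ?t = 0" using s arc_breaks(4) by blast
    have "reduced_segment k k' xs (bvp_arc r \<alpha> \<beta>) 0 (arc_out ?s r ?t)"
      using arc_reduced_segment[OF orb, of ?s ?t] unfolding in0 bvp_arc_def .
    moreover have "bvp_arc r \<alpha> \<beta> ` {0..arc_out ?s r ?t} \<subseteq> crit_mfd_rep"
      using arc_middle[of _ ?s r ?t] r_bounds unfolding in0 bvp_arc_def
      by (auto simp: crit_mfd_rep_def crit_mfd_def)
    moreover have "i = 1 \<Longrightarrow> layer_at_1 (<) (bvp_arc r \<alpha> \<beta>) (arc_out ?s r ?t)"
      "i = 2 \<Longrightarrow> layer_at_1 (>) (bvp_arc r \<alpha> \<beta>) (arc_out ?s r ?t)"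
      using arc_layer_at_1(2,3)[of ?t r ?s] b1 exit \<beta> \<beta>' unfolding r1[symmetric] bvp_arc_def by auto
    ultimately show "has_type k k' xs i (bvp_arc r \<alpha> \<beta>)"
      using \<beta> unfolding has_type_def rep_then_layer_def by blast
  next
    fix \<gamma> assume sp: "singular_path k k' xs \<alpha> \<beta> \<gamma>" and "has_type k k' xs i \<gamma>"
    then obtain b where seg: "reduced_segment k k' xs \<gamma> 0 b" and rep: "\<gamma> ` {0..b} \<subseteq> crit_mfd_rep"
      and lay: "layer_at_1 (<) \<gamma> b \<or> layer_at_1 (>) \<gamma> b"
      using \<beta> unfolding has_type_def rep_then_layer_def by auto
    have b: "0 < b" using seg unfolding reduced_segment_def by blast
    have rep': "\<gamma> x \<in> crit_mfd \<and> rho_of (\<gamma> x) < 1/2" if "x \<in> {0..b}" for x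
      using rep that unfolding crit_mfd_rep_def by blast
    have xib: "xi_of (\<gamma> b) = 1" using lay unfolding layer_at_1_def by blast
    have left: "\<gamma> 0 \<in> left_pts \<alpha>" using sp unfolding singular_path_def pathstart_def by blast
    then have xi0: "xi_of (\<gamma> 0) = 0" and "j_of (\<gamma> 0) = \<alpha> * (1 - rho_of (\<gamma> 0))"
      unfolding left_pts_def by auto
    moreover have "j_of (\<gamma> 0) = rho_of (\<gamma> 0) * (1 - rho_of (\<gamma> 0))" and lt: "rho_of (\<gamma> 0) < 1/2"
      using rep'[of 0] b unfolding crit_mfd_def by auto
    \<comment> \<open>Both expressions for the flux contain the factor \<open>1 - \<rho>\<close>,
      which is nonzero since \<open>\<rho> < 1/2\<close>.\<close>
    ultimately have "rho_of (\<gamma> 0) = \<alpha>" by auto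
    have xi_in: "xi_of (\<gamma> x) \<in> {0..1}" if "x \<in> {0..b}" for x
    proof -
      have mono: "strict_mono_on {0..b} (\<lambda>t. xi_of (\<gamma> t))" using seg unfolding reduced_segment_def by blast
      show ?thesis
        using strict_mono_on_leD[OF mono, of 0 x] strict_mono_on_leD[OF mono, of x b] that xi0 xib by auto
    qed
    have "rho_of (\<gamma> x) = r (xi_of (\<gamma> x))" if "x \<in> {0..b}" for x
    proof (rule reduced_segment_rho_eq[OF seg xi0 xib orb _ _ _ that])
      show "rho_of (\<gamma> 0) = r (xi_of (\<gamma> 0))" using xi0 r0 \<open>rho_of (\<gamma> 0) = \<alpha>\<close> by simp
    qed (use b rep' r_bounds xi_in in auto)
    then show "\<exists>a b. follows_orbit r \<gamma> a b"
      using follows_orbitI[OF seg xi0 xib] lay by blast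
  qed (use \<alpha> \<beta>' in auto)
qed

text \<open>The orbit is fixed from its far end: on the attracting side the boundary condition at
  \<xi> = 1 meets the critical manifold only at \<open>1 - \<beta>\<close>. Traced back along the
  upper branch, it starts at \<open>rho_lower_star k \<beta>\<close>.\<close>

lemma unique_layer_then_attr:
  assumes \<beta>: "0 < \<beta>" "\<beta> < 1 - rho_c1 k xs"
    and \<alpha>: "i = 7 \<and> 1 - rho_lower_star k \<beta> < \<alpha> \<and> \<alpha> < rho_lower_star k \<beta> \<or>
      i = 8 \<and> rho_lower_star k \<beta> < \<alpha> \<and> \<alpha> < 1"
  shows "\<exists>!\<Gamma>. \<Gamma> \<in> singular_solutions k k' xs \<alpha> \<beta> i \<and>
           (\<forall>\<gamma>\<in>\<Gamma>. xi_of (\<gamma> 0) = 0 \<and> j_of (\<gamma> 0) = \<alpha> * (1 - rho_of (\<gamma> 0)) \<and>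
                  xi_of (\<gamma> 1) = 1 \<and> j_of (\<gamma> 1) = \<beta> * rho_of (\<gamma> 1))"
proof -
  define c where "c = 4 * \<beta> * (1 - \<beta>) * k 1"
  define r where "r x = (1 + 1 * sqrt (1 - c / k x)) / 2" for x
  have \<beta>_half: "\<beta> < 1/2" using \<beta>(2) rho_c_bounds by linarith
  \<comment> \<open>\<open>1 - rho_c1 k xs\<close> is the lower root at \<xi> = 1, the form required
    by \<open>below_sqrt_branch\<close>.\<close>
  have "\<beta> < (1 - sqrt (1 - k xs / k 1)) / 2"
  proof -
    have "1 - (1 + u) / 2 = (1 - u) / 2" for u :: real by (simp add: field_simps)
    from this[of "sqrt (1 - k xs / k 1)"] show ?thesis using \<beta>(2) unfolding rho_c1_def by metis
  qed
  then have "4 * \<beta> * (1 - \<beta>) < 1 - (1 - k xs / k 1)"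
    using k_ends by (intro below_sqrt_branch) auto
  then have "c < k xs" using k_ends by (simp add: c_def field_simps)
  then have c: "0 < c" "\<And>x. x \<in> {0..1} \<Longrightarrow> c < k x"
    using \<beta> \<beta>_half k_ends k_ge by (auto simp: c_def less_le_trans)
  have orb: "reduced_orbit k k' xs {0..1} r"
    unfolding r_def by (rule reduced_orbit_sqrt_branch[OF k]) (use c in auto)
  have r_bounds: "1/2 < r x \<and> r x < 1" if "x \<in> {0..1}" for x
  proof -
    have "0 < c / k x" "c / k x < 1" using c that kpos[OF that] by auto
    then show ?thesis by (simp add: r_def)
  qed
  have r1: "r 1 = 1 - \<beta>"
    using sqrt_branch_height[of \<beta>] \<beta>_half k_ends by (simp add: r_def c_def)
  have r0: "r 0 = rho_lower_star k \<beta>" by (simp add: r_def c_def rho_lower_star_def)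
  have b0: "1/2 < r 0" "r 0 < 1" "0 < r 0" using r_bounds[of 0] by auto
  then have \<alpha>': "0 < \<alpha>" "1 - r 0 \<le> \<alpha>" using \<alpha> unfolding r0[symmetric] by auto
  let ?s = "1 - r 0 * (1 - r 0) / \<alpha>" and ?t = "r 1 * (1 - r 1) / \<beta>"
  have t: "?t = r 1" using \<beta> r1 by simp
  note entry = entry_height[of "r 0" \<alpha>]
  show ?thesis
  proof (rule unique_oriented_curve[of \<alpha> \<beta> _ _ _ r])
    show "singular_path k k' xs \<alpha> \<beta> (bvp_arc r \<alpha> \<beta>)"
      using orb r_bounds[of 1] b0 \<beta> \<alpha>' r1 by (intro singular_path_bvp_arc) auto
    have out1: "arc_out ?s r ?t = 1" using t arc_breaks(5) by blast
    have "reduced_segment k k' xs (bvp_arc r \<alpha> \<beta>) (arc_in ?s r ?t) 1"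
      using arc_reduced_segment[OF orb, of ?s ?t] unfolding out1 bvp_arc_def .
    moreover have "bvp_arc r \<alpha> \<beta> ` {arc_in ?s r ?t..1} \<subseteq> crit_mfd_attr"
      using arc_middle[of _ ?s r ?t] r_bounds unfolding out1 bvp_arc_def
      by (auto simp: crit_mfd_attr_def crit_mfd_def)
    moreover have "i = 7 \<Longrightarrow> layer_at_0 (<) (bvp_arc r \<alpha> \<beta>) (arc_in ?s r ?t)"
      "i = 8 \<Longrightarrow> layer_at_0 (>) (bvp_arc r \<alpha> \<beta>) (arc_in ?s r ?t)"
      using arc_layer_at_0(2,3)[of ?s r ?t] b0 entry \<alpha> \<alpha>' unfolding r0[symmetric] bvp_arc_def by auto
    ultimately show "has_type k k' xs i (bvp_arc r \<alpha> \<beta>)"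
      using \<alpha> unfolding has_type_def layer_then_attr_def by blast
  next
    fix \<gamma> assume sp: "singular_path k k' xs \<alpha> \<beta> \<gamma>" and "has_type k k' xs i \<gamma>"
    then obtain a where seg: "reduced_segment k k' xs \<gamma> a 1" and attr: "\<gamma> ` {a..1} \<subseteq> crit_mfd_attr"
      and lay: "layer_at_0 (<) \<gamma> a \<or> layer_at_0 (>) \<gamma> a"
      using \<alpha> unfolding has_type_def layer_then_attr_def by auto
    have a: "a < 1" using seg unfolding reduced_segment_def by blast
    have attr': "\<gamma> x \<in> crit_mfd \<and> rho_of (\<gamma> x) > 1/2" if "x \<in> {a..1}" for x
      using attr that unfolding crit_mfd_attr_def by blast
    have xia: "xi_of (\<gamma> a) = 0" using lay unfolding layer_at_0_def by blast
    have right: "\<gamma> 1 \<in> right_pts \<beta>" using sp unfolding singular_path_def pathfinish_def by blast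
    then have xi1: "xi_of (\<gamma> 1) = 1" and "j_of (\<gamma> 1) = \<beta> * rho_of (\<gamma> 1)"
      unfolding right_pts_def by auto
    moreover have "j_of (\<gamma> 1) = rho_of (\<gamma> 1) * (1 - rho_of (\<gamma> 1))" and lt: "rho_of (\<gamma> 1) > 1/2"
      using attr'[of 1] a unfolding crit_mfd_def by auto
    ultimately have "rho_of (\<gamma> 1) = 1 - \<beta>" by auto
    have xi_in: "xi_of (\<gamma> x) \<in> {0..1}" if "x \<in> {a..1}" for x
    proof -
      have mono: "strict_mono_on {a..1} (\<lambda>t. xi_of (\<gamma> t))" using seg unfolding reduced_segment_def by blast
      show ?thesis
        using strict_mono_on_leD[OF mono, of a x] strict_mono_on_leD[OF mono, of x 1] that xi1 xia by auto
    qed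
    have "rho_of (\<gamma> x) = r (xi_of (\<gamma> x))" if "x \<in> {a..1}" for x
    proof (rule reduced_segment_rho_eq[OF seg xia xi1 orb _ _ _ that])
      show "rho_of (\<gamma> 1) = r (xi_of (\<gamma> 1))" using xi1 r1 \<open>rho_of (\<gamma> 1) = 1 - \<beta>\<close> by simp
    qed (use a attr' r_bounds xi_in in auto)
    then show "\<exists>a b. follows_orbit r \<gamma> a b"
      using follows_orbitI[OF seg xia xi1] lay by blast
  qed (use \<beta> \<alpha>' in auto)
qed

text \<open>The orbit is the canard for all boundary data; \<alpha> alone decides the direction of
  the entry layer and \<beta> alone that of the exit layer, which gives the four types.\<close>

lemma unique_layer_canard_layer:
  assumes \<alpha>: "(i = 3 \<or> i = 4) \<and> rho_c0 k xs < \<alpha> \<and> \<alpha> < 1 - rho_c0 k xs \<or>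
      (i = 5 \<or> i = 6) \<and> 1 - rho_c0 k xs < \<alpha> \<and> \<alpha> < 1"
    and \<beta>: "(i = 3 \<or> i = 5) \<and> 1 - rho_c1 k xs < \<beta> \<and> \<beta> < rho_c1 k xs \<or>
      (i = 4 \<or> i = 6) \<and> rho_c1 k xs < \<beta> \<and> \<beta> < 1"
  shows "\<exists>!\<Gamma>. \<Gamma> \<in> singular_solutions k k' xs \<alpha> \<beta> i \<and>
           (\<forall>\<gamma>\<in>\<Gamma>. xi_of (\<gamma> 0) = 0 \<and> j_of (\<gamma> 0) = \<alpha> * (1 - rho_of (\<gamma> 0)) \<and>
                  xi_of (\<gamma> 1) = 1 \<and> j_of (\<gamma> 1) = \<beta> * rho_of (\<gamma> 1))"
proof -
  let ?r = "canard k xs"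
  have r0: "?r 0 = 1 - rho_c0 k xs" and r1: "?r 1 = 1 - rho_c1 k xs"
    using xs by (auto simp: canard_def rho_c0_def rho_c1_def field_simps)
  have b: "1/2 < ?r 0" "?r 0 < 1" "0 < ?r 0" "0 < ?r 1" "?r 1 < 1/2" "?r 1 < 1"
    unfolding r0 r1 using rho_c_bounds by linarith+
  have \<alpha>r: "(i = 3 \<or> i = 4) \<and> 1 - ?r 0 < \<alpha> \<and> \<alpha> < ?r 0 \<or> (i = 5 \<or> i = 6) \<and> ?r 0 < \<alpha> \<and> \<alpha> < 1"
    using \<alpha> unfolding r0 by simp
  have \<beta>r: "(i = 3 \<or> i = 5) \<and> ?r 1 < \<beta> \<and> \<beta> < 1 - ?r 1 \<or> (i = 4 \<or> i = 6) \<and> 1 - ?r 1 < \<beta> \<and> \<beta> < 1"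
    using \<beta> unfolding r1 by simp
  have pos: "0 < \<alpha>" "1 - ?r 0 \<le> \<alpha>" "0 < \<beta>" "?r 1 \<le> \<beta>" using \<alpha>r \<beta>r b by auto
  have orb: "reduced_orbit k k' xs {0..1} ?r"
    by (rule reduced_orbit_canard[OF k k' kpos xs min crit])
  have mid: "?r xs = 1/2" using k_ends by (simp add: canard_def)
  let ?s = "1 - ?r 0 * (1 - ?r 0) / \<alpha>" and ?t = "?r 1 * (1 - ?r 1) / \<beta>"
  note entry = entry_height[of "?r 0" \<alpha>]
  note exit = exit_height[of "?r 1" \<beta>]
  show ?thesis
  proof (rule unique_oriented_curve[of \<alpha> \<beta> _ _ _ ?r])
    show "singular_path k k' xs \<alpha> \<beta> (bvp_arc ?r \<alpha> \<beta>)"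
      using orb b pos by (intro singular_path_bvp_arc) auto
    let ?a = "arc_in ?s ?r ?t" and ?b = "arc_out ?s ?r ?t" and ?N = "arc_length ?s ?r ?t"
    have "reduced_segment k k' xs (bvp_arc ?r \<alpha> \<beta>) ?a ?b"
      using arc_reduced_segment[OF orb] unfolding bvp_arc_def .
    moreover have "canard_pt xs \<in> bvp_arc ?r \<alpha> \<beta> ` {?a..?b}"
    proof
      \<comment> \<open>The parameter at which \<open>u = xs\<close>.\<close>
      let ?x = "(xs + \<bar>?r 0 - ?s\<bar>) / ?N"
      have N: "?N > 0" by (rule arc_length_pos)
      show x: "?x \<in> {?a..?b}"
        using xs N by (auto simp: arc_in_def arc_out_def divide_right_mono)
      have "?N * ?x - \<bar>?r 0 - ?s\<bar> = xs" using N by simp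
      then show "canard_pt xs = bvp_arc ?r \<alpha> \<beta> ?x"
        unfolding bvp_arc_def arc_middle(1)[OF x] by (simp only: mid canard_pt_def) simp
    qed
    moreover have "i = 3 \<or> i = 4 \<Longrightarrow> layer_at_0 (<) (bvp_arc ?r \<alpha> \<beta>) ?a"
      "i = 5 \<or> i = 6 \<Longrightarrow> layer_at_0 (>) (bvp_arc ?r \<alpha> \<beta>) ?a"
      using arc_layer_at_0(2,3)[of ?s ?r ?t] b entry \<alpha>r pos unfolding bvp_arc_def by auto
    moreover have "i = 3 \<or> i = 5 \<Longrightarrow> layer_at_1 (<) (bvp_arc ?r \<alpha> \<beta>) ?b"
      "i = 4 \<or> i = 6 \<Longrightarrow> layer_at_1 (>) (bvp_arc ?r \<alpha> \<beta>) ?b"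
      using arc_layer_at_1(2,3)[of ?t ?r ?s] b exit \<beta>r pos unfolding bvp_arc_def by auto
    ultimately show "has_type k k' xs i (bvp_arc ?r \<alpha> \<beta>)"
      using \<alpha> \<beta> unfolding has_type_def layer_canard_layer_def by blast
  next
    fix \<gamma> assume "singular_path k k' xs \<alpha> \<beta> \<gamma>" and "has_type k k' xs i \<gamma>"
    then obtain a b where seg: "reduced_segment k k' xs \<gamma> a b" and pt: "canard_pt xs \<in> \<gamma> ` {a..b}"
      and lay: "layer_at_0 (<) \<gamma> a \<or> layer_at_0 (>) \<gamma> a" "layer_at_1 (<) \<gamma> b \<or> layer_at_1 (>) \<gamma> b"
      using \<alpha> unfolding has_type_def layer_canard_layer_def by auto
    have xi: "xi_of (\<gamma> a) = 0" "xi_of (\<gamma> b) = 1"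
      using lay unfolding layer_at_0_def layer_at_1_def by blast+
    obtain r where r: "reduced_orbit k k' xs {0..1} r" "\<forall>t\<in>{a..b}. rho_of (\<gamma> t) = r (xi_of (\<gamma> t))"
      using seg xi unfolding reduced_segment_def by auto
    obtain x where "x \<in> {a..b}" "\<gamma> x = (1/4, xs, 1/2)"
      using pt unfolding canard_pt_def by (metis imageE)
    \<comment> \<open>This value excludes orbits staying strictly on one side of \<open>1/2\<close>,
      so only the canard alternative of \<open>reduced_orbit\<close> is left.\<close>
    then have "r xs = 1/2" using r(2) by fastforce
    moreover have "xs \<in> {0..1}" using xs by auto
    ultimately have can: "\<forall>x\<in>{0..1}. r x = ?r x"
      using r(1) unfolding reduced_orbit_def by (metis less_irrefl)
    have mono: "strict_mono_on {a..b} (\<lambda>t. xi_of (\<gamma> t))" using seg unfolding reduced_segment_def by blast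
    have "rho_of (\<gamma> x) = ?r (xi_of (\<gamma> x))" if "x \<in> {a..b}" for x
    proof -
      have "xi_of (\<gamma> x) \<in> {0..1}"
        using strict_mono_on_leD[OF mono, of a x] strict_mono_on_leD[OF mono, of x b] that xi by auto
      then show ?thesis using can r(2) that by simp
    qed
    then show "\<exists>a b. follows_orbit ?r \<gamma> a b"
      using follows_orbitI[OF seg xi] lay by blast
  qed (use pos in auto)
qed

end

theorem proposition1:
  fixes k k' k'' :: "real \<Rightarrow> real" and xs \<alpha> \<beta> :: real and i :: nat
  assumes "\<And>x. x \<in> {0..1} \<Longrightarrow> (k has_real_derivative k' x) (at x within {0..1})"
    and "\<And>x. x \<in> {0..1} \<Longrightarrow> (k' has_real_derivative k'' x) (at x within {0..1})"
    and "continuous_on {0..1} k''"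
    and "\<And>x. x \<in> {0..1} \<Longrightarrow> k x > 0"
    and "xs \<in> {0<..<1}"
    and "\<And>x. x \<in> {0..1} \<Longrightarrow> x \<noteq> xs \<Longrightarrow> k xs < k x"
    and "k' xs = 0" and "k'' xs > 0"
    and "i \<in> {1..8}"
    and "(\<alpha>, \<beta>) \<in> region k xs i"
  shows "\<exists>!\<Gamma>. \<Gamma> \<in> singular_solutions k k' xs \<alpha> \<beta> i \<and>
           (\<forall>\<gamma>\<in>\<Gamma>. xi_of (\<gamma> 0) = 0 \<and> j_of (\<gamma> 0) = \<alpha> * (1 - rho_of (\<gamma> 0)) \<and>
                  xi_of (\<gamma> 1) = 1 \<and> j_of (\<gamma> 1) = \<beta> * rho_of (\<gamma> 1))"
proof -
  interpret bottleneck k k' k'' xs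
    using assms by unfold_locales
  from assms(10) consider "i = 1 \<or> i = 2" | "i = 3 \<or> i = 4 \<or> i = 5 \<or> i = 6" | "i = 7 \<or> i = 8"
    unfolding region_def Let_def by auto
  then show ?thesis
  proof cases
    case 1
    then show ?thesis
      using assms(10) unfolding region_def Let_def by (intro unique_rep_then_layer) auto
  next
    case 2
    then show ?thesis
      using assms(10) unfolding region_def Let_def by (intro unique_layer_canard_layer) auto
  next
    case 3
    then show ?thesis
      using assms(10) unfolding region_def Let_def by (intro unique_layer_then_attr) auto
  qed
qed

end
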